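(* Let $\mathcal C$ be a semi-value configuration of the main calculus that is well-formed with type $A$. Then there is no infinite sequence of reductions $$\mathcal C\leadsto_{p_0}\mathcal C_1\leadsto_{p_1}\mathcal C_2\leadsto_{p_2}\cdots .$$
   Context: **PURE QUANTUM LANGUAGE.** **Syntax.** Ground quantum types: $Q::=I\mid Q\oplus Q\mid Q\otimes Q\mid\mathrm{qnat}$, with $\mathrm{qbit}:=I\oplus I$. Unitary types: $U(Q_1,Q_2)$. Let $x$ range over variables and $\alpha$ over complex scalars; all index sets are finite. Basis values: $b::=*\mid x\mid\mathrm{inl}\,b\mid\mathrm{inr}\,b\mid b\otimes b\mid 0\mid S\,b$ (a total order on them is fixed). Quantum values: $v::=\sum_{i\in I}(\alpha_i\cdot b_i)$ with the $b_i$ in increasing order and all $\alpha_i\neq 0$. Expressions: $e::=*\mid x\mid\mathrm{inl}\,e\mid\mathrm{inr}\,e\mid e\otimes e\mid 0\mid S\,e\mid\sum_{i\in I}(\alpha_i\cdot e_i)$. Unitaries: $u::=\{b_1\mapsto e_1\mid\dots\mid b_n\mapsto e_n\}\mid u\otimes u\mid u\oplus u\mid u\circ u\mid u^*\mid\mathrm{ctrl}\,u$. Quantum terms: $t::=*\mid x\mid\mathrm{inl}\,t\mid\mathrm{inr}\,t\mid t\otimes t\mid 0\mid S\,t\mid u\,t\mid\sum_{i\in I}(\alpha_i\cdot t_i)$. **Orthogonality** $\perp$ is the smallest symmetric relation on quantum terms such that: $\mathrm{inl}\,t_1\perp\mathrm{inr}\,t_2$; $0\perp S\,t$; if $t_1\perp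 t_2$ then $S\,t_1\perp S\,t_2$, $\mathrm{inl}\,t_1\perp\mathrm{inl}\,t_2$, $\mathrm{inr}\,t_1\perp\mathrm{inr}\,t_2$, $u\,t_1\perp u\,t_2$, and, for all $t,t'$, $t\otimes t_1\perp t'\otimes t_2$ and $t_1\otimes t\perp t_2\otimes t'$; if $t\perp t_i$ for all $i\in I$ then $t\perp\sum_{i\in I}(\alpha_i\cdot t_i)$; if $t\perp t_i$ for all $i\in I$, $\alpha_\star=0$ and $t_\star=t$, then $t\perp\sum_{i\in I\cup\{\star\}}(\alpha_i\cdot t_i)$; if $t_i\perp t_j$ for all $i\ne j\in I$, $J,K\subseteq I$ and $\sum_{i\in J\cap K}\overline{\alpha_i}\beta_i=0$, then $\sum_{j\in J}(\alpha_j\cdot t_j)\perp\sum_{k\in K}(\beta_k\cdot t_k)$. **Orthonormal bases.** For a set $S$ of elements of the form $b\otimes b'$, $\pi_1(S),\pi_2(S)$ are the sets of first, resp. second, components, $S^1_b=\{b'\mid b\otimes b'\in S\}$ and $S^2_b=\{b'\mid b'\otimes b\in S\}$. $\mathrm{ONB}_Q$ is the smallest predicate on finite sets of basis values with: $\mathrm{ONB}_Q(\{x\})$; $\mathrm{ONB}_I(\{*\})$; if $\mathrm{ONB}_{Q_1}(S)$ and $\mathrm{ONB}_{Q_2}(T)$ then $\mathrm{ONB}_{Q_1\oplus Q_2}(\{\mathrm{inl}\,b\mid b\in S\}\cup\{\mathrm{inr}\,b\mid b\in T\})$; if $\mathrm{ONB}_{\mathrm{qnat}}(S)$ then $\mathrm{ONB}_{\mathrm{qnat}}(\{0\}\cup\{S\,b\mid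 b\in S\})$; $\mathrm{ONB}_{Q_1\otimes Q_2}(S)$ if $\mathrm{ONB}_{Q_2}(\pi_2(S))$ and $\mathrm{ONB}_{Q_1}(S^2_b)$ for all $b\in\pi_2(S)$; $\mathrm{ONB}_{Q_1\otimes Q_2}(S)$ if $\mathrm{ONB}_{Q_1}(\pi_1(S))$ and $\mathrm{ONB}_{Q_2}(S^1_b)$ for all $b\in\pi_1(S)$. $\mathrm{ONB}^e_Q$ is the predicate on finite sets of expressions generated by the same rules (for expressions) together with: if $\mathrm{ONB}^e_Q(S)$ and $(\alpha_{e,e'})_{(e,e')\in S\times S}$ is a unitary matrix then $\mathrm{ONB}^e_Q(\{\sum_{e'\in S}(\alpha_{e,e'}\cdot e')\mid e\in S\})$. **Pure typing** (contexts $\Gamma$ are finite sets of pairs $x:Q$, used strictly linearly). $\vdash *:I$; $x:Q\vdash x:Q$; $\Gamma_1,\Gamma_2\vdash t_1\otimes t_2:Q_1\otimes Q_2$ if $\Gamma_i\vdash t_i:Q_i$; $\Gamma\vdash\mathrm{inl}\,t:Q_1\oplus Q_2$ if $\Gamma\vdash t:Q_1$; $\Gamma\vdash\mathrm{inr}\,t:Q_1\oplus Q_2$ if $\Gamma\vdash t:Q_2$; $\vdash 0:\mathrm{qnat}$; $\Gamma\vdash S\,t:\mathrm{qnat}$ if $\Gamma\vdash t:\mathrm{qnat}$; $\Gamma\vdash\sum_i(\alpha_i\cdot t_i):Q$ if $\Gamma\vdash t_i:Q$ for all $i$, $\sum_i|\alpha_i|^2=1$ and $t_i\perp t_j$ for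 $i\neq j$; $\Gamma\vdash u\,t:Q_2$ if $\Vdash u:U(Q_1,Q_2)$ and $\Gamma\vdash t:Q_1$. Unitaries: $\Vdash\{b_1\mapsto e_1\mid\dots\mid b_n\mapsto e_n\}:U(Q_1,Q_2)$ if there are $\Gamma_i$ with $\Gamma_i\vdash b_i:Q_1$, $\Gamma_i\vdash e_i:Q_2$, $\mathrm{ONB}_{Q_1}(\{b_1,\dots,b_n\})$ and $\mathrm{ONB}^e_{Q_2}(\{e_1,\dots,e_n\})$ (the $b_i$ pairwise distinct, the $e_i$ pairwise distinct); $u^*:U(Q_2,Q_1)$ if $u:U(Q_1,Q_2)$; $u_2\circ u_1:U(Q_1,Q_3)$ if $u_1:U(Q_1,Q_2)$, $u_2:U(Q_2,Q_3)$; $u_1\otimes u_2:U(Q_1\otimes Q_3,Q_2\otimes Q_4)$ and $u_1\oplus u_2:U(Q_1\oplus Q_3,Q_2\oplus Q_4)$ if $u_1:U(Q_1,Q_2)$, $u_2:U(Q_3,Q_4)$; $\mathrm{ctrl}\,u:U(\mathrm{qbit}\otimes Q,\mathrm{qbit}\otimes Q)$ if $u:U(Q,Q)$. **Matching.** A valuation $\sigma$ is a finite partial map from variables to expressions; $\sigma(t)$ denotes substitution. $\mathrm{match}(\emptyset,*,* )$; $\mathrm{match}(\{x\mapsto b'\},x,b')$; $\mathrm{match}(\emptyset,0,0)$; $\mathrm{match}(\sigma,b,b')$ implies $\mathrm{match}(\sigma,\mathrm{inl}\,b,\mathrm{inl}\,b')$, $\mathrm{match}(\sigma,\mathrm{inr}\,b,\mathrm{inr}\,b')$,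 $\mathrm{match}(\sigma,S\,b,S\,b')$; $\mathrm{match}(\sigma_1,b_1,b_1')$, $\mathrm{match}(\sigma_2,b_2,b_2')$ with disjoint supports imply $\mathrm{match}(\sigma_1\cup\sigma_2,b_1\otimes b_2,b_1'\otimes b_2')$. **Pure equational theory.** $\Gamma\vdash t_1=t_2:Q$ is generated by reflexivity (for well-formed terms), symmetry, transitivity and: (linear algebra, left-hand sides or displayed components well-formed) permuting the summands of a sum; deleting a summand with scalar $0$; $\sum_{i=1}^1(1\cdot t)=t$; $\sum_i(\alpha_i\cdot\sum_j(\beta_{ij}\cdot t_j))=\sum_j((\sum_i\alpha_i\beta_{ij})\cdot t_j)$; $\sum_i(\alpha_i\cdot\sum_j(\beta_{ij}\cdot t_{ij}))=\sum_{ij}(\alpha_i\beta_{ij}\cdot t_{ij})$ provided the right-hand side is well-formed; $C[\sum_i(\alpha_i\cdot t_i)]=\sum_i(\alpha_i\cdot C[t_i])$ for $C[-]$ one of $u\,-$, $\mathrm{inl}\,-$, $\mathrm{inr}\,-$, $S\,-$, $t\otimes-$, $-\otimes t$; (congruence) from $t_1=t_2$ infer $C[t_1]=C[t_2]$ for the same $C$, and from $\Gamma\vdash\sum_i(\alpha_i\cdot t_i):Q$ and $t_i=t_i'$ for all $i$ infer $\sum_i(\alpha_i\cdot t_i)=\sum_i(\alpha_i\cdot t_i')$; (computation, $b$'s basis values, closed except in the rule for $\circ$, $v$ a value) $\{b_1\mapsto e_1\mid\dots\mid b_n\mapsto e_n\}\,b'=\sigma(e_i)$ if $\mathrm{match}(\sigma,b_i,b')$;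 from $u\,b=v$ infer $u^*\,v=b$; $(u_2\circ u_1)\,b=u_2\,(u_1\,b)$; $(u_1\otimes u_2)(b_1\otimes b_2)=(u_1\,b_1)\otimes(u_2\,b_2)$; $(u_1\oplus u_2)(\mathrm{inl}\,b)=\mathrm{inl}\,(u_1\,b)$; $(u_1\oplus u_2)(\mathrm{inr}\,b)=\mathrm{inr}\,(u_2\,b)$; $(\mathrm{ctrl}\,u)((\mathrm{inl}\,* )\otimes b)=(\mathrm{inl}\,* )\otimes b$; $(\mathrm{ctrl}\,u)((\mathrm{inr}\,* )\otimes b)=(\mathrm{inr}\,* )\otimes(u\,b)$. **MAIN CALCULUS.** **Types and terms.** Types: $A,B::=I\mid A+B\mid A\otimes B\mid{!A}\mid A\multimap B\mid\mathrm{Nat}\mid\mathcal B(Q)$. Terms: $L,M,N::=*\mid x\mid\mathit{inl}(M)\mid\mathit{inr}(M)\mid\mathit{case}\,L\,\mathit{of}\,\{\mathit{inl}(x)\to M,\mathit{inr}(y)\to N\}\mid M\otimes N\mid\mathit{let}\,x\otimes y=M\,\mathit{in}\,N\mid\mathit{lift}(M)\mid\mathit{force}(M)\mid\lambda x.M\mid M\,N\mid\mathit{zero}\mid\mathit{succ}(M)\mid\mathit{match}\,L\,\mathit{with}\,\{\mathit{zero}\to M,\mathit{succ}(x)\to N\}\mid\mathit{pure}(t)\mid\mathit{meas}(M)\mid\mathcal B(u)(M)\mid\mathit{let}\,\mathcal B(z)=M\,\mathit{in}\,N\mid\mathit{let}\,\mathcal B(x\otimes y)=M\,\mathit{in}\,N$.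 Values: $V,W::=*\mid x\mid\mathit{inl}(V)\mid\mathit{inr}(V)\mid V\otimes W\mid\mathit{lift}(M)\mid\lambda x.M\mid\mathit{zero}\mid\mathit{succ}(V)$. Classical analogues: $\overline I=I$, $\overline{Q_1\otimes Q_2}=\overline{Q_1}\otimes\overline{Q_2}$, $\overline{Q_1\oplus Q_2}=\overline{Q_1}+\overline{Q_2}$, $\overline{\mathrm{qnat}}=\mathrm{Nat}$; $\overline*=*$, $\overline{b_1\otimes b_2}=\overline{b_1}\otimes\overline{b_2}$, $\overline{\mathrm{inl}\,b}=\mathit{inl}(\overline b)$, $\overline{\mathrm{inr}\,b}=\mathit{inr}(\overline b)$, $\overline0=\mathit{zero}$, $\overline{S\,b}=\mathit{succ}(\overline b)$. **Typing.** Contexts $\Delta,\Sigma$ are finite sequences $x_1:A_1,\dots,x_n:A_n$ (exchange allowed); $!\Delta$ denotes a context all of whose types are of the form $!A$; comma is disjoint union. $!\Delta\vdash*:I$; $!\Delta,x:A\vdash x:A$; $\mathit{inl}(M):A+B$ if $M:A$ and $\mathit{inr}(M):A+B$ if $M:B$ (same context); $!\Delta,\Sigma_1,\Sigma_2\vdash\mathit{case}\,L\,\mathit{of}\,\{\dots\}:C$ if $!\Delta,\Sigma_1\vdash L:A+B$, $!\Delta,\Sigma_2,x:A\vdash M:C$, $!\Delta,\Sigma_2,y:B\vdash N:C$; $!\Delta,\Sigma_1,\Sigma_2\vdash M\otimes N:A\otimes B$ if $!\Delta,\Sigma_1\vdash M:A$, $!\Delta,\Sigma_2\vdash N:B$;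 $!\Delta,\Sigma_1,\Sigma_2\vdash\mathit{let}\,x\otimes y=M\,\mathit{in}\,N:C$ if $!\Delta,\Sigma_1\vdash M:A\otimes B$, $!\Delta,\Sigma_2,x:A,y:B\vdash N:C$; $!\Delta\vdash\mathit{lift}(M):{!A}$ if $!\Delta\vdash M:A$; $\Delta\vdash\mathit{force}(M):A$ if $\Delta\vdash M:{!A}$; $\Delta\vdash\lambda x.M:A\multimap B$ if $\Delta,x:A\vdash M:B$; $!\Delta,\Sigma_1,\Sigma_2\vdash M\,N:B$ if $!\Delta,\Sigma_1\vdash M:A\multimap B$, $!\Delta,\Sigma_2\vdash N:A$; $!\Delta\vdash\mathit{zero}:\mathrm{Nat}$; $\Delta\vdash\mathit{succ}(M):\mathrm{Nat}$ if $\Delta\vdash M:\mathrm{Nat}$; $!\Delta,\Sigma_1,\Sigma_2\vdash\mathit{match}\,L\,\mathit{with}\,\{\dots\}:A$ if $!\Delta,\Sigma_1\vdash L:\mathrm{Nat}$, $!\Delta,\Sigma_2\vdash M:A$, $!\Delta,\Sigma_2,x:\mathrm{Nat}\vdash N:A$; $!\Delta\vdash\mathit{pure}(t):\mathcal B(Q)$ if $\cdot\vdash t:Q$ in the pure language; $\Delta\vdash\mathit{meas}(M):\overline Q$ if $\Delta\vdash M:\mathcal B(Q)$; $\Delta\vdash\mathcal B(u)(M):\mathcal B(Q_2)$ if $\Vdash u:U(Q_1,Q_2)$, $\Delta\vdash M:\mathcal B(Q_1)$; $!\Delta,\Sigma_1,\Sigma_2\vdash\mathit{let}\,\mathcal B(z)=M\,\mathit{in}\,N:A$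 if $!\Delta,\Sigma_1\vdash M:\mathcal B(Q_1)\otimes\mathcal B(Q_2)$, $!\Delta,\Sigma_2,z:\mathcal B(Q_1\otimes Q_2)\vdash N:A$; $!\Delta,\Sigma_1,\Sigma_2\vdash\mathit{let}\,\mathcal B(x\otimes y)=M\,\mathit{in}\,N:A$ if $!\Delta,\Sigma_1\vdash M:\mathcal B(Q_1\otimes Q_2)$, $!\Delta,\Sigma_2,x:\mathcal B(Q_1),y:\mathcal B(Q_2)\vdash N:A$. **Configurations.** A quantum configuration is a triple $(t,u_\sigma,M)$ with $t$ a quantum term, $u_\sigma$ a unitary representing a canonical symmetric monoidal isomorphism (built from unitors, associators, symmetries, $\circ$, $\otimes$; below called a permutation), and $M$ a main-calculus term. It is a value configuration if $t$ is a quantum value and $M$ a value; a semi-value configuration if $t$ is a quantum value. It is well-formed with type $A$ if $\cdot\vdash t:Q_1\otimes\cdots\otimes Q_n$, $\Vdash u_\sigma:U(Q_1\otimes\cdots\otimes Q_n,Q_1'\otimes\cdots\otimes Q_m')$ and $x_1:\mathcal B(Q_1'),\dots,x_m:\mathcal B(Q_m')\vdash M:A$, the variables $x_1,\dots,x_m$ being listed in the order in which they occur in $M$, so that $x_i$ represents the $i$-th block of $u_\sigma t$ (an empty tensor is $I$, with term $*$). More generally one allows auxiliary quantum data: $u_\sigma$ has target $Q_1'\otimes\cdots\otimes Q_m'\otimes Q_1''\otimes\cdots\otimes Q_k''$, where only the first $m$ blocks are represented by variables. Configurations are taken up to renaming of variables, and permutations are identified when they denote the same isomorphism. **Evaluation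 contexts.** $E::=[\cdot]\mid E\otimes N\mid V\otimes E\mid\mathit{let}\,x\otimes y=E\,\mathit{in}\,N\mid\mathit{inl}(E)\mid\mathit{inr}(E)\mid\mathit{case}\,E\,\mathit{of}\,\{\dots\}\mid\mathit{force}(E)\mid\mathit{succ}(E)\mid\mathit{match}\,E\,\mathit{with}\,\{\dots\}\mid E\,N\mid V\,E\mid\mathit{meas}(E)\mid\mathcal B(u)(E)\mid\mathit{let}\,\mathcal B(z)=E\,\mathit{in}\,N\mid\mathit{let}\,\mathcal B(x\otimes y)=E\,\mathit{in}\,N$. **Small-step rules** $\to_p$ on configurations. The following leave $t,u_\sigma$ unchanged and have $p=1$: $\mathit{case}\,\mathit{inl}(V)\,\mathit{of}\{\mathit{inl}(x)\to M,\mathit{inr}(y)\to N\}\to M[V/x]$, and with $\mathit{inr}(V)$: $\to N[V/y]$; $\mathit{let}\,x\otimes y=V\otimes W\,\mathit{in}\,M\to M[V/x,W/y]$; $\mathit{force}(\mathit{lift}(M))\to M$; $(\lambda x.M)V\to M[V/x]$; $\mathit{match}\,\mathit{zero}\,\mathit{with}\{\mathit{zero}\to M,\mathit{succ}(x)\to N\}\to M$, and with $\mathit{succ}(V)$: $\to N[V/x]$. Further: $(t,u_\sigma,\mathit{pure}(t'))\to_1(t\otimes t',u_{\mathrm{swap}}\circ(u_\sigma\otimes u_{id}),x)$ with $u_{\mathrm{swap}}=\{x\otimes y\mapsto y\otimes x\}$; $(\sum_ip_i\cdot\sum_j\alpha_{ij}\cdot b'_{ij}\otimes\cdots\otimes b_i\otimes\cdots\otimes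 b''_{ij},u_{\sigma_s},\mathit{meas}(x))\to_{|p_k|^2}(\sum_j\alpha_{kj}\cdot b'_{kj}\otimes\cdots\otimes b''_{kj},u_{id},\overline{b_k})$ for each $k$, where $b_i$ is in the tensor position $s$ to which $x$ is linked, the $b_i$ are pairwise distinct, $p_i>0$, and $u_{\sigma_s}$ moves position $s$ to the front; $(t,u_\sigma,\mathcal B(u)(z))\to_1((u_\sigma^*\circ(u\otimes id)\circ u_\sigma)\,t,u_\sigma,z)$; $(t,u_\sigma,\mathit{let}\,\mathcal B(z)=x\otimes y\,\mathit{in}\,N)\to_1(t,u_{\mathrm{gather}}\circ u_\sigma,N)$, where $u_{\mathrm{gather}}$ merges the adjacent blocks of $x$ and $y$ into one block, represented by $z$; $(t,u_\sigma,\mathit{let}\,\mathcal B(x\otimes y)=z\,\mathit{in}\,N)\to_1(t,u_{\mathrm{divide}}\circ u_\sigma,N)$, where $u_{\mathrm{divide}}$ splits the block of $z$ into two blocks, represented by $x$ and $y$; contextual rule: if $(t_1,u_{\sigma_1^{ext}},M_1)\to_p(t_2,u_{\sigma_2^{ext}},M_2)$ and $\mathrm{dom}(\sigma)\cap(\mathrm{dom}(\sigma_1)\cup\mathrm{dom}(\sigma_2))=\emptyset$, then $(t_1,u_{\sigma^{ext}\circ\sigma_1^{ext}},E[M_1])\to_p(t_2,u_{\sigma^{ext}\circ\sigma_2^{ext}},E[M_2])$. Here $\sigma^{ext}$ extends a permutation by the identity on additional indices; in the premise the components represented by variables of $E$ are auxiliary, and in the conclusion they stay linked to the same variables. **Reduction**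 $\leadsto_p$ on semi-value configurations: $(v,u_\sigma,M)\leadsto_p(v',u_{\sigma'},M')$ iff there are quantum terms $t,t'$ with $\cdot\vdash v=t:Q$, $(t,u_\sigma,M)\to_p(t',u_{\sigma'},M')$ and $\cdot\vdash t'=v':Q'$, where $v,v'$ are quantum values. *)

theory Defs
  imports Complex_Main "HOL-Library.Multiset"
begin

type_synonym name = nat

section \<open>The pure quantum language\<close>

subsection \<open>Syntax\<close>

datatype qty = QI | QPlus qty qty | QTens qty qty | QNat

abbreviation qbit :: qty where "qbit \<equiv> QPlus QI QI"

datatype basis =
    BStar
  | BVar name
  | BInl basis
  | BInr basis
  | BTens basis basis
  | BZero
  | BSucc basis

text \<open>Families indexed by a finite set are lists, whose order is immaterial up to the equational
  theory.\<close>

datatype expr =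
    EStar
  | EVar name
  | EInl expr
  | EInr expr
  | ETens expr expr
  | EZero
  | ESucc expr
  | ESum "(complex \<times> expr) list"

datatype unitary =
    UClauses "(basis \<times> expr) list"
  | UTens unitary unitary
  | UPlus unitary unitary
  | UComp unitary unitary  \<comment> \<open>\<open>UComp u2 u1\<close> is \<open>u2 \<circ> u1\<close>\<close>
  | UDag unitary
  | UCtrl unitary

datatype qterm =
    TStar
  | TVar name
  | TInl qterm
  | TInr qterm
  | TTens qterm qterm
  | TZero
  | TSucc qterm
  | TApp unitary qterm
  | TSum "(complex \<times> qterm) list"

primrec expr_of_basis :: "basis \<Rightarrow> expr" where
  "expr_of_basis BStar = EStar"
| "expr_of_basis (BVar x) = EVar x"
| "expr_of_basis (BInl b) = EInl (expr_of_basis b)"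
| "expr_of_basis (BInr b) = EInr (expr_of_basis b)"
| "expr_of_basis (BTens b c) = ETens (expr_of_basis b) (expr_of_basis c)"
| "expr_of_basis BZero = EZero"
| "expr_of_basis (BSucc b) = ESucc (expr_of_basis b)"

primrec term_of_expr :: "expr \<Rightarrow> qterm" where
  "term_of_expr EStar = TStar"
| "term_of_expr (EVar x) = TVar x"
| "term_of_expr (EInl e) = TInl (term_of_expr e)"
| "term_of_expr (EInr e) = TInr (term_of_expr e)"
| "term_of_expr (ETens e f) = TTens (term_of_expr e) (term_of_expr f)"
| "term_of_expr EZero = TZero"
| "term_of_expr (ESucc e) = TSucc (term_of_expr e)"
| "term_of_expr (ESum es) = TSum (map (map_prod id term_of_expr) es)"

abbreviation term_of_basis :: "basis \<Rightarrow> qterm" where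
  "term_of_basis b \<equiv> term_of_expr (expr_of_basis b)"

primrec closed_basis :: "basis \<Rightarrow> bool" where
  "closed_basis BStar = True"
| "closed_basis (BVar x) = False"
| "closed_basis (BInl b) = closed_basis b"
| "closed_basis (BInr b) = closed_basis b"
| "closed_basis (BTens b c) = (closed_basis b \<and> closed_basis c)"
| "closed_basis BZero = True"
| "closed_basis (BSucc b) = closed_basis b"

text \<open>The fixed total order on basis values is the parameter \<open>r\<close> here and in everything that
  mentions quantum values.\<close>

definition is_qvalue :: "basis rel \<Rightarrow> qterm \<Rightarrow> bool" where
  "is_qvalue r t \<longleftrightarrow>
     (\<exists>l :: (complex \<times> basis) list.
        t = TSum (map (map_prod id term_of_basis) l) \<and>
        (\<forall>(\<alpha>, b) \<in> set l. \<alpha> \<noteq> 0) \<and>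
        sorted_wrt (\<lambda>b c. (b, c) \<in> r \<and> b \<noteq> c) (map snd l))"

subsection \<open>Orthogonality\<close>

inductive orth :: "qterm \<Rightarrow> qterm \<Rightarrow> bool" (infix "\<bottom>\<^sub>q" 50) where
  orth_sym: "t1 \<bottom>\<^sub>q t2 \<Longrightarrow> t2 \<bottom>\<^sub>q t1"
| orth_inl_inr: "TInl t1 \<bottom>\<^sub>q TInr t2"
| orth_zero_succ: "TZero \<bottom>\<^sub>q TSucc t"
| orth_succ: "t1 \<bottom>\<^sub>q t2 \<Longrightarrow> TSucc t1 \<bottom>\<^sub>q TSucc t2"
| orth_inl: "t1 \<bottom>\<^sub>q t2 \<Longrightarrow> TInl t1 \<bottom>\<^sub>q TInl t2"
| orth_inr: "t1 \<bottom>\<^sub>q t2 \<Longrightarrow> TInr t1 \<bottom>\<^sub>q TInr t2"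
| orth_app: "t1 \<bottom>\<^sub>q t2 \<Longrightarrow> TApp u t1 \<bottom>\<^sub>q TApp u t2"
| orth_tens_right: "t1 \<bottom>\<^sub>q t2 \<Longrightarrow> TTens t t1 \<bottom>\<^sub>q TTens t' t2"
| orth_tens_left: "t1 \<bottom>\<^sub>q t2 \<Longrightarrow> TTens t1 t \<bottom>\<^sub>q TTens t2 t'"
| orth_sum: "(\<forall>(\<alpha>, s) \<in> set ts. t \<bottom>\<^sub>q s) \<Longrightarrow> t \<bottom>\<^sub>q TSum ts"
| orth_sum_zero:
    "(\<forall>(\<alpha>, s) \<in> set (ts @ ts'). t \<bottom>\<^sub>q s) \<Longrightarrow> t \<bottom>\<^sub>q TSum (ts @ (0, t) # ts')"
| orth_sum_sum:
    "\<lbrakk>\<forall>i < length ts. \<forall>j < length ts. i \<noteq> j \<longrightarrow> ts ! i \<bottom>\<^sub>q ts ! j;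
      distinct J; set J \<subseteq> {..<length ts};
      distinct K; set K \<subseteq> {..<length ts};
      (\<Sum>i \<in> set J \<inter> set K. cnj (\<alpha> i) * \<beta> i) = 0\<rbrakk>
     \<Longrightarrow> TSum (map (\<lambda>j. (\<alpha> j, ts ! j)) J) \<bottom>\<^sub>q TSum (map (\<lambda>k. (\<beta> k, ts ! k)) K)"

subsection \<open>Orthonormal bases\<close>

inductive onb :: "qty \<Rightarrow> basis set \<Rightarrow> bool" where
  onb_var: "onb Q {BVar x}"
| onb_star: "onb QI {BStar}"
| onb_plus: "\<lbrakk>onb Q1 S; onb Q2 T\<rbrakk> \<Longrightarrow> onb (QPlus Q1 Q2) (BInl ` S \<union> BInr ` T)"
| onb_nat: "onb QNat S \<Longrightarrow> onb QNat ({BZero} \<union> BSucc ` S)"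
| onb_tens2:
    "\<lbrakk>S \<subseteq> range (case_prod BTens);
      onb Q2 {b. \<exists>b'. BTens b' b \<in> S};
      \<forall>b \<in> {b. \<exists>b'. BTens b' b \<in> S}. onb Q1 {b'. BTens b' b \<in> S}\<rbrakk>
     \<Longrightarrow> onb (QTens Q1 Q2) S"
| onb_tens1:
    "\<lbrakk>S \<subseteq> range (case_prod BTens);
      onb Q1 {b. \<exists>b'. BTens b b' \<in> S};
      \<forall>b \<in> {b. \<exists>b'. BTens b b' \<in> S}. onb Q2 {b'. BTens b b' \<in> S}\<rbrakk>
     \<Longrightarrow> onb (QTens Q1 Q2) S"

definition unitary_matrix_on :: "'i set \<Rightarrow> ('i \<Rightarrow> 'i \<Rightarrow> complex) \<Rightarrow> bool" where
  "unitary_matrix_on S \<alpha> \<longleftrightarrow>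
     (\<forall>i \<in> S. \<forall>j \<in> S. (\<Sum>k \<in> S. \<alpha> i k * cnj (\<alpha> j k)) = (if i = j then 1 else 0)) \<and>
     (\<forall>i \<in> S. \<forall>j \<in> S. (\<Sum>k \<in> S. cnj (\<alpha> k i) * \<alpha> k j) = (if i = j then 1 else 0))"

text \<open>In the last rule \<open>es e\<close> enumerates \<open>S\<close> in an arbitrary order.\<close>

inductive onbe :: "qty \<Rightarrow> expr set \<Rightarrow> bool" where
  onbe_var: "onbe Q {EVar x}"
| onbe_star: "onbe QI {EStar}"
| onbe_plus: "\<lbrakk>onbe Q1 S; onbe Q2 T\<rbrakk> \<Longrightarrow> onbe (QPlus Q1 Q2) (EInl ` S \<union> EInr ` T)"
| onbe_nat: "onbe QNat S \<Longrightarrow> onbe QNat ({EZero} \<union> ESucc ` S)"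
| onbe_tens2:
    "\<lbrakk>S \<subseteq> range (case_prod ETens);
      onbe Q2 {e. \<exists>e'. ETens e' e \<in> S};
      \<forall>e \<in> {e. \<exists>e'. ETens e' e \<in> S}. onbe Q1 {e'. ETens e' e \<in> S}\<rbrakk>
     \<Longrightarrow> onbe (QTens Q1 Q2) S"
| onbe_tens1:
    "\<lbrakk>S \<subseteq> range (case_prod ETens);
      onbe Q1 {e. \<exists>e'. ETens e e' \<in> S};
      \<forall>e \<in> {e. \<exists>e'. ETens e e' \<in> S}. onbe Q2 {e'. ETens e e' \<in> S}\<rbrakk>
     \<Longrightarrow> onbe (QTens Q1 Q2) S"
| onbe_unitary:
    "\<lbrakk>onbe Q S; unitary_matrix_on S \<alpha>; \<forall>e \<in> S. distinct (es e) \<and> set (es e) = S\<rbrakk>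
     \<Longrightarrow> onbe Q ((\<lambda>e. ESum (map (\<lambda>e'. (\<alpha> e e', e')) (es e))) ` S)"

subsection \<open>Typing\<close>

type_synonym qctx = "name \<rightharpoonup> qty"

inductive qtyped :: "qctx \<Rightarrow> qterm \<Rightarrow> qty \<Rightarrow> bool"
  and utyped :: "unitary \<Rightarrow> qty \<Rightarrow> qty \<Rightarrow> bool" where
  qt_star: "qtyped Map.empty TStar QI"
| qt_var: "qtyped [x \<mapsto> Q] (TVar x) Q"
| qt_tens:
    "\<lbrakk>qtyped \<Gamma>1 t1 Q1; qtyped \<Gamma>2 t2 Q2; dom \<Gamma>1 \<inter> dom \<Gamma>2 = {}\<rbrakk>
     \<Longrightarrow> qtyped (\<Gamma>1 ++ \<Gamma>2) (TTens t1 t2) (QTens Q1 Q2)"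
| qt_inl: "qtyped \<Gamma> t Q1 \<Longrightarrow> qtyped \<Gamma> (TInl t) (QPlus Q1 Q2)"
| qt_inr: "qtyped \<Gamma> t Q2 \<Longrightarrow> qtyped \<Gamma> (TInr t) (QPlus Q1 Q2)"
| qt_zero: "qtyped Map.empty TZero QNat"
| qt_succ: "qtyped \<Gamma> t QNat \<Longrightarrow> qtyped \<Gamma> (TSucc t) QNat"
| qt_sum:
    "\<lbrakk>\<forall>(\<alpha>, t) \<in> set ts. qtyped \<Gamma> t Q;
      (\<Sum>(\<alpha>, t) \<leftarrow> ts. (cmod \<alpha>)\<^sup>2) = 1;
      \<forall>i < length ts. \<forall>j < length ts. i \<noteq> j \<longrightarrow> snd (ts ! i) \<bottom>\<^sub>q snd (ts ! j)\<rbrakk>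
     \<Longrightarrow> qtyped \<Gamma> (TSum ts) Q"
| qt_app: "\<lbrakk>utyped u Q1 Q2; qtyped \<Gamma> t Q1\<rbrakk> \<Longrightarrow> qtyped \<Gamma> (TApp u t) Q2"
| ut_clauses:
    "\<lbrakk>\<forall>(b, e) \<in> set cs. \<exists>\<Gamma>. qtyped \<Gamma> (term_of_basis b) Q1 \<and> qtyped \<Gamma> (term_of_expr e) Q2;
      distinct (map fst cs); distinct (map snd cs);
      onb Q1 (set (map fst cs)); onbe Q2 (set (map snd cs))\<rbrakk>
     \<Longrightarrow> utyped (UClauses cs) Q1 Q2"
| ut_dag: "utyped u Q1 Q2 \<Longrightarrow> utyped (UDag u) Q2 Q1"
| ut_comp: "\<lbrakk>utyped u1 Q1 Q2; utyped u2 Q2 Q3\<rbrakk> \<Longrightarrow> utyped (UComp u2 u1) Q1 Q3"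
| ut_tens:
    "\<lbrakk>utyped u1 Q1 Q2; utyped u2 Q3 Q4\<rbrakk>
     \<Longrightarrow> utyped (UTens u1 u2) (QTens Q1 Q3) (QTens Q2 Q4)"
| ut_plus:
    "\<lbrakk>utyped u1 Q1 Q2; utyped u2 Q3 Q4\<rbrakk>
     \<Longrightarrow> utyped (UPlus u1 u2) (QPlus Q1 Q3) (QPlus Q2 Q4)"
| ut_ctrl: "utyped u Q Q \<Longrightarrow> utyped (UCtrl u) (QTens qbit Q) (QTens qbit Q)"

subsection \<open>Matching\<close>

type_synonym valuation = "name \<rightharpoonup> expr"

primrec subst_expr :: "valuation \<Rightarrow> expr \<Rightarrow> expr" where
  "subst_expr \<sigma> EStar = EStar"
| "subst_expr \<sigma> (EVar x) = (case \<sigma> x of None \<Rightarrow> EVar x | Some e \<Rightarrow> e)"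
| "subst_expr \<sigma> (EInl e) = EInl (subst_expr \<sigma> e)"
| "subst_expr \<sigma> (EInr e) = EInr (subst_expr \<sigma> e)"
| "subst_expr \<sigma> (ETens e f) = ETens (subst_expr \<sigma> e) (subst_expr \<sigma> f)"
| "subst_expr \<sigma> EZero = EZero"
| "subst_expr \<sigma> (ESucc e) = ESucc (subst_expr \<sigma> e)"
| "subst_expr \<sigma> (ESum es) = ESum (map (map_prod id (subst_expr \<sigma>)) es)"

inductive qmatch :: "valuation \<Rightarrow> basis \<Rightarrow> basis \<Rightarrow> bool" where
  "qmatch Map.empty BStar BStar"
| "qmatch [x \<mapsto> expr_of_basis b'] (BVar x) b'"
| "qmatch Map.empty BZero BZero"
| "qmatch \<sigma> b b' \<Longrightarrow> qmatch \<sigma> (BInl b) (BInl b')"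
| "qmatch \<sigma> b b' \<Longrightarrow> qmatch \<sigma> (BInr b) (BInr b')"
| "qmatch \<sigma> b b' \<Longrightarrow> qmatch \<sigma> (BSucc b) (BSucc b')"
| "\<lbrakk>qmatch \<sigma>1 b1 b1'; qmatch \<sigma>2 b2 b2'; dom \<sigma>1 \<inter> dom \<sigma>2 = {}\<rbrakk>
   \<Longrightarrow> qmatch (\<sigma>1 ++ \<sigma>2) (BTens b1 b2) (BTens b1' b2')"

subsection \<open>Equational theory\<close>

definition lin_ctxs :: "(qterm \<Rightarrow> qterm) set" where
  "lin_ctxs = range TApp \<union> {TInl, TInr, TSucc} \<union> range TTens \<union> range (\<lambda>t s. TTens s t)"

inductive qeq :: "basis rel \<Rightarrow> qctx \<Rightarrow> qterm \<Rightarrow> qterm \<Rightarrow> qty \<Rightarrow> bool" for r where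
  qeq_refl: "qtyped \<Gamma> t Q \<Longrightarrow> qeq r \<Gamma> t t Q"
| qeq_sym: "qeq r \<Gamma> t1 t2 Q \<Longrightarrow> qeq r \<Gamma> t2 t1 Q"
| qeq_trans: "\<lbrakk>qeq r \<Gamma> t1 t2 Q; qeq r \<Gamma> t2 t3 Q\<rbrakk> \<Longrightarrow> qeq r \<Gamma> t1 t3 Q"
| qeq_perm:
    "\<lbrakk>qtyped \<Gamma> (TSum ts) Q; mset ts = mset ts'\<rbrakk> \<Longrightarrow> qeq r \<Gamma> (TSum ts) (TSum ts') Q"
| qeq_zero:
    "qtyped \<Gamma> (TSum (ts @ (0, t) # ts')) Q
     \<Longrightarrow> qeq r \<Gamma> (TSum (ts @ (0, t) # ts')) (TSum (ts @ ts')) Q"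
| qeq_single: "qtyped \<Gamma> t Q \<Longrightarrow> qeq r \<Gamma> (TSum [(1, t)]) t Q"
| qeq_sum_common:
    "qtyped \<Gamma> (TSum (map (\<lambda>i. (\<alpha> i, TSum (map (\<lambda>j. (\<beta> i j, ts ! j)) [0..<length ts]))) [0..<m])) Q
     \<Longrightarrow> qeq r \<Gamma>
           (TSum (map (\<lambda>i. (\<alpha> i, TSum (map (\<lambda>j. (\<beta> i j, ts ! j)) [0..<length ts]))) [0..<m]))
           (TSum (map (\<lambda>j. (\<Sum>i<m. \<alpha> i * \<beta> i j, ts ! j)) [0..<length ts])) Q"
| qeq_sum_flatten:
    "qtyped \<Gamma> (TSum (concat (map (\<lambda>(\<alpha>, ts). map (\<lambda>(\<beta>, t). (\<alpha> * \<beta>, t)) ts) tss))) Q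
     \<Longrightarrow> qeq r \<Gamma>
           (TSum (map (\<lambda>(\<alpha>, ts). (\<alpha>, TSum ts)) tss))
           (TSum (concat (map (\<lambda>(\<alpha>, ts). map (\<lambda>(\<beta>, t). (\<alpha> * \<beta>, t)) ts) tss))) Q"
| qeq_linear:
    "\<lbrakk>C \<in> lin_ctxs; qtyped \<Gamma> (C (TSum ts)) Q\<rbrakk>
     \<Longrightarrow> qeq r \<Gamma> (C (TSum ts)) (TSum (map (\<lambda>(\<alpha>, t). (\<alpha>, C t)) ts)) Q"
| qeq_cong_app:
    "\<lbrakk>utyped u Q1 Q2; qeq r \<Gamma> t1 t2 Q1\<rbrakk> \<Longrightarrow> qeq r \<Gamma> (TApp u t1) (TApp u t2) Q2"
| qeq_cong_inl: "qeq r \<Gamma> t1 t2 Q1 \<Longrightarrow> qeq r \<Gamma> (TInl t1) (TInl t2) (QPlus Q1 Q2)"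
| qeq_cong_inr: "qeq r \<Gamma> t1 t2 Q2 \<Longrightarrow> qeq r \<Gamma> (TInr t1) (TInr t2) (QPlus Q1 Q2)"
| qeq_cong_succ: "qeq r \<Gamma> t1 t2 QNat \<Longrightarrow> qeq r \<Gamma> (TSucc t1) (TSucc t2) QNat"
| qeq_cong_tens_right:
    "\<lbrakk>qtyped \<Gamma>' t Q'; qeq r \<Gamma> t1 t2 Q; dom \<Gamma>' \<inter> dom \<Gamma> = {}\<rbrakk>
     \<Longrightarrow> qeq r (\<Gamma>' ++ \<Gamma>) (TTens t t1) (TTens t t2) (QTens Q' Q)"
| qeq_cong_tens_left:
    "\<lbrakk>qeq r \<Gamma> t1 t2 Q; qtyped \<Gamma>' t Q'; dom \<Gamma> \<inter> dom \<Gamma>' = {}\<rbrakk>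
     \<Longrightarrow> qeq r (\<Gamma> ++ \<Gamma>') (TTens t1 t) (TTens t2 t) (QTens Q Q')"
| qeq_cong_sum:
    "\<lbrakk>qtyped \<Gamma> (TSum (map (\<lambda>(\<alpha>, t, t'). (\<alpha>, t)) ts)) Q;
      \<forall>(\<alpha>, t, t') \<in> set ts. qeq r \<Gamma> t t' Q\<rbrakk>
     \<Longrightarrow> qeq r \<Gamma> (TSum (map (\<lambda>(\<alpha>, t, t'). (\<alpha>, t)) ts)) (TSum (map (\<lambda>(\<alpha>, t, t'). (\<alpha>, t')) ts)) Q"
| qeq_clauses:
    "\<lbrakk>closed_basis b'; qtyped Map.empty (TApp (UClauses cs) (term_of_basis b')) Q;
      (b, e) \<in> set cs; qmatch \<sigma> b b'\<rbrakk>
     \<Longrightarrow> qeq r Map.empty (TApp (UClauses cs) (term_of_basis b')) (term_of_expr (subst_expr \<sigma> e)) Q"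
| qeq_dag:
    "\<lbrakk>closed_basis b; is_qvalue r v; utyped u Q1 Q2; qtyped Map.empty (term_of_basis b) Q1;
      qeq r Map.empty (TApp u (term_of_basis b)) v Q2\<rbrakk>
     \<Longrightarrow> qeq r Map.empty (TApp (UDag u) v) (term_of_basis b) Q1"
| qeq_comp:
    "qtyped \<Gamma> (TApp (UComp u2 u1) (term_of_basis b)) Q
     \<Longrightarrow> qeq r \<Gamma> (TApp (UComp u2 u1) (term_of_basis b)) (TApp u2 (TApp u1 (term_of_basis b))) Q"
| qeq_tens:
    "\<lbrakk>closed_basis b1; closed_basis b2;
      qtyped Map.empty (TApp (UTens u1 u2) (TTens (term_of_basis b1) (term_of_basis b2))) Q\<rbrakk>
     \<Longrightarrow> qeq r Map.empty (TApp (UTens u1 u2) (TTens (term_of_basis b1) (term_of_basis b2)))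
           (TTens (TApp u1 (term_of_basis b1)) (TApp u2 (term_of_basis b2))) Q"
| qeq_plus_inl:
    "\<lbrakk>closed_basis b; qtyped Map.empty (TApp (UPlus u1 u2) (TInl (term_of_basis b))) Q\<rbrakk>
     \<Longrightarrow> qeq r Map.empty (TApp (UPlus u1 u2) (TInl (term_of_basis b)))
           (TInl (TApp u1 (term_of_basis b))) Q"
| qeq_plus_inr:
    "\<lbrakk>closed_basis b; qtyped Map.empty (TApp (UPlus u1 u2) (TInr (term_of_basis b))) Q\<rbrakk>
     \<Longrightarrow> qeq r Map.empty (TApp (UPlus u1 u2) (TInr (term_of_basis b)))
           (TInr (TApp u2 (term_of_basis b))) Q"
| qeq_ctrl_inl:
    "\<lbrakk>closed_basis b; qtyped Map.empty (TApp (UCtrl u) (TTens (TInl TStar) (term_of_basis b))) Q\<rbrakk>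
     \<Longrightarrow> qeq r Map.empty (TApp (UCtrl u) (TTens (TInl TStar) (term_of_basis b)))
           (TTens (TInl TStar) (term_of_basis b)) Q"
| qeq_ctrl_inr:
    "\<lbrakk>closed_basis b; qtyped Map.empty (TApp (UCtrl u) (TTens (TInr TStar) (term_of_basis b))) Q\<rbrakk>
     \<Longrightarrow> qeq r Map.empty (TApp (UCtrl u) (TTens (TInr TStar) (term_of_basis b)))
           (TTens (TInr TStar) (TApp u (term_of_basis b))) Q"

subsection \<open>Permutations\<close>

text \<open>The unitaries representing canonical symmetric monoidal isomorphisms. The inverses of the
  unitors and associators are generators too.\<close>

inductive is_perm :: "unitary \<Rightarrow> bool" where
  "is_perm (UClauses [(BVar x, EVar x)])"
| "x \<noteq> y \<Longrightarrow> is_perm (UClauses [(BTens (BVar x) (BVar y), ETens (EVar y) (EVar x))])"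
| "distinct [x, y, z]
   \<Longrightarrow> is_perm (UClauses [(BTens (BTens (BVar x) (BVar y)) (BVar z),
                           ETens (EVar x) (ETens (EVar y) (EVar z)))])"
| "distinct [x, y, z]
   \<Longrightarrow> is_perm (UClauses [(BTens (BVar x) (BTens (BVar y) (BVar z)),
                           ETens (ETens (EVar x) (EVar y)) (EVar z))])"
| "is_perm (UClauses [(BTens BStar (BVar x), EVar x)])"
| "is_perm (UClauses [(BVar x, ETens EStar (EVar x))])"
| "is_perm (UClauses [(BTens (BVar x) BStar, EVar x)])"
| "is_perm (UClauses [(BVar x, ETens (EVar x) EStar)])"
| "\<lbrakk>is_perm u1; is_perm u2\<rbrakk> \<Longrightarrow> is_perm (UComp u2 u1)"
| "\<lbrakk>is_perm u1; is_perm u2\<rbrakk> \<Longrightarrow> is_perm (UTens u1 u2)"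

text \<open>\<open>perm_maps u b c\<close>: the isomorphism denoted by the permutation \<open>u\<close> sends the basis vector
  \<open>b\<close> to the basis vector \<open>c\<close>.\<close>

inductive perm_maps :: "unitary \<Rightarrow> basis \<Rightarrow> basis \<Rightarrow> bool" where
  "\<lbrakk>qmatch \<sigma> p b; subst_expr \<sigma> e = expr_of_basis c\<rbrakk> \<Longrightarrow> perm_maps (UClauses [(p, e)]) b c"
| "\<lbrakk>perm_maps u1 b c; perm_maps u2 c d\<rbrakk> \<Longrightarrow> perm_maps (UComp u2 u1) b d"
| "\<lbrakk>perm_maps u1 b1 c1; perm_maps u2 b2 c2\<rbrakk>
   \<Longrightarrow> perm_maps (UTens u1 u2) (BTens b1 b2) (BTens c1 c2)"

definition u_id :: unitary where
  "u_id = UClauses [(BVar 0, EVar 0)]"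

definition u_swap :: unitary where
  "u_swap = UClauses [(BTens (BVar 0) (BVar 1), ETens (EVar 1) (EVar 0))]"

text \<open>An \<open>n\<close>-fold tensor of blocks is bracketed to the right and ends with the unit. Thus it is
  \<open>I\<close> for \<open>n = 0\<close>, and splitting off the first block does not depend on whether others follow.\<close>

primrec qty_tensor :: "qty list \<Rightarrow> qty" where
  "qty_tensor [] = QI"
| "qty_tensor (Q # Qs) = QTens Q (qty_tensor Qs)"

primrec basis_tensor :: "basis list \<Rightarrow> basis" where
  "basis_tensor [] = BStar"
| "basis_tensor (b # bs) = BTens b (basis_tensor bs)"

definition u_gather :: unitary where
  "u_gather = UClauses [(BTens (BVar 0) (BTens (BVar 1) (BVar 2)),
                         ETens (ETens (EVar 0) (EVar 1)) (EVar 2))]"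

definition u_divide :: unitary where
  "u_divide = UClauses [(BTens (BTens (BVar 0) (BVar 1)) (BVar 2),
                         ETens (EVar 0) (ETens (EVar 1) (EVar 2)))]"

text \<open>The extension \<open>\<sigma>\<^sup>e\<^sup>x\<^sup>t\<close> of a permutation, with \<open>m\<close> additional indices in front.\<close>

primrec u_ext :: "nat \<Rightarrow> unitary \<Rightarrow> unitary" where
  "u_ext 0 u = u"
| "u_ext (Suc m) u = UTens u_id (u_ext m u)"

section \<open>The main calculus\<close>

subsection \<open>Types and terms\<close>

datatype mty =
    TyI
  | TyPlus mty mty
  | TyTens mty mty
  | TyBang mty
  | TyLolli mty mty
  | TyNat
  | TyB qty

text \<open>Terms up to renaming of bound variables, in locally nameless style: free variables are named,
  bound variables are de Bruijn indices. A subterm in the scope of a pair of bound variables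
  \<open>x\<close>, \<open>y\<close> refers to \<open>x\<close> by index 0 and to \<open>y\<close> by index 1 (plus the number of binders in between).\<close>

datatype (fv: 'v) mterm =
    MStar
  | Free 'v
  | Bound nat
  | Inl "'v mterm"
  | Inr "'v mterm"
  | Case "'v mterm" "'v mterm" "'v mterm"      \<comment> \<open>one bound variable in each branch\<close>
  | Tens "'v mterm" "'v mterm"
  | LetTens "'v mterm" "'v mterm"              \<comment> \<open>two bound variables in the second argument\<close>
  | Lift "'v mterm"
  | Force "'v mterm"
  | Lam "'v mterm"
  | App "'v mterm" "'v mterm"
  | Zero
  | Succ "'v mterm"
  | MatchNat "'v mterm" "'v mterm" "'v mterm"  \<comment> \<open>one bound variable in the third argument\<close>
  | Pure qterm
  | Meas "'v mterm"
  | ApplyU unitary "'v mterm"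
  | LetGather "'v mterm" "'v mterm"            \<comment> \<open>one bound variable in the second argument\<close>
  | LetDivide "'v mterm" "'v mterm"            \<comment> \<open>two bound variables in the second argument\<close>
  for map: rename

type_synonym main_term = "name mterm"

text \<open>\<open>subst_bound k Vs M\<close> replaces the indices \<open>k, \<dots>, k + length Vs - 1\<close> by \<open>Vs\<close>. No capture
  can occur, because the terms \<open>Vs\<close> substituted below have no dangling indices.\<close>

primrec subst_bound :: "nat \<Rightarrow> 'v mterm list \<Rightarrow> 'v mterm \<Rightarrow> 'v mterm" where
  "subst_bound k Vs MStar = MStar"
| "subst_bound k Vs (Free x) = Free x"
| "subst_bound k Vs (Bound i) = (if k \<le> i \<and> i < k + length Vs then Vs ! (i - k) else Bound i)"
| "subst_bound k Vs (Inl M) = Inl (subst_bound k Vs M)"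
| "subst_bound k Vs (Inr M) = Inr (subst_bound k Vs M)"
| "subst_bound k Vs (Case L M N) =
     Case (subst_bound k Vs L) (subst_bound (k + 1) Vs M) (subst_bound (k + 1) Vs N)"
| "subst_bound k Vs (Tens M N) = Tens (subst_bound k Vs M) (subst_bound k Vs N)"
| "subst_bound k Vs (LetTens M N) = LetTens (subst_bound k Vs M) (subst_bound (k + 2) Vs N)"
| "subst_bound k Vs (Lift M) = Lift (subst_bound k Vs M)"
| "subst_bound k Vs (Force M) = Force (subst_bound k Vs M)"
| "subst_bound k Vs (Lam M) = Lam (subst_bound (k + 1) Vs M)"
| "subst_bound k Vs (App M N) = App (subst_bound k Vs M) (subst_bound k Vs N)"
| "subst_bound k Vs Zero = Zero"
| "subst_bound k Vs (Succ M) = Succ (subst_bound k Vs M)"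
| "subst_bound k Vs (MatchNat L M N) =
     MatchNat (subst_bound k Vs L) (subst_bound k Vs M) (subst_bound (k + 1) Vs N)"
| "subst_bound k Vs (Pure t) = Pure t"
| "subst_bound k Vs (Meas M) = Meas (subst_bound k Vs M)"
| "subst_bound k Vs (ApplyU u M) = ApplyU u (subst_bound k Vs M)"
| "subst_bound k Vs (LetGather M N) = LetGather (subst_bound k Vs M) (subst_bound (k + 1) Vs N)"
| "subst_bound k Vs (LetDivide M N) = LetDivide (subst_bound k Vs M) (subst_bound (k + 2) Vs N)"

abbreviation inst :: "'v mterm \<Rightarrow> 'v mterm list \<Rightarrow> 'v mterm" where
  "inst M Vs \<equiv> subst_bound 0 Vs M"

primrec is_value :: "'v mterm \<Rightarrow> bool" where
  "is_value MStar = True"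
| "is_value (Free x) = True"
| "is_value (Bound i) = False"
| "is_value (Inl M) = is_value M"
| "is_value (Inr M) = is_value M"
| "is_value (Case L M N) = False"
| "is_value (Tens M N) = (is_value M \<and> is_value N)"
| "is_value (LetTens M N) = False"
| "is_value (Lift M) = True"
| "is_value (Force M) = False"
| "is_value (Lam M) = True"
| "is_value (App M N) = False"
| "is_value Zero = True"
| "is_value (Succ M) = is_value M"
| "is_value (MatchNat L M N) = False"
| "is_value (Pure t) = False"
| "is_value (Meas M) = False"
| "is_value (ApplyU u M) = False"
| "is_value (LetGather M N) = False"
| "is_value (LetDivide M N) = False"

primrec classical_ty :: "qty \<Rightarrow> mty" where
  "classical_ty QI = TyI"
| "classical_ty (QTens Q1 Q2) = TyTens (classical_ty Q1) (classical_ty Q2)"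
| "classical_ty (QPlus Q1 Q2) = TyPlus (classical_ty Q1) (classical_ty Q2)"
| "classical_ty QNat = TyNat"

text \<open>Only closed basis values have a classical analogue.\<close>

fun classical :: "basis \<Rightarrow> 'v mterm" where
  "classical BStar = MStar"
| "classical (BTens b c) = Tens (classical b) (classical c)"
| "classical (BInl b) = Inl (classical b)"
| "classical (BInr b) = Inr (classical b)"
| "classical BZero = Zero"
| "classical (BSucc b) = Succ (classical b)"

subsection \<open>Typing\<close>

text \<open>Sequences of typed, pairwise distinct variables modulo exchange are finite partial maps.\<close>

type_synonym mctx = "name \<rightharpoonup> mty"

definition bang_ctx :: "mctx \<Rightarrow> bool" where
  "bang_ctx \<Delta> \<longleftrightarrow> finite (dom \<Delta>) \<and> ran \<Delta> \<subseteq> range TyBang"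

text \<open>\<open>split_ctx \<Gamma> \<Gamma>1 \<Gamma>2\<close>: \<open>\<Gamma>\<close> is \<open>!\<Delta>, \<Sigma>1, \<Sigma>2\<close>, where \<open>\<Gamma>1\<close> is \<open>!\<Delta>, \<Sigma>1\<close> and \<open>\<Gamma>2\<close> is \<open>!\<Delta>, \<Sigma>2\<close>.\<close>

definition split_ctx :: "mctx \<Rightarrow> mctx \<Rightarrow> mctx \<Rightarrow> bool" where
  "split_ctx \<Gamma> \<Gamma>1 \<Gamma>2 \<longleftrightarrow>
     (\<exists>\<Delta> \<Sigma>1 \<Sigma>2. bang_ctx \<Delta> \<and>
        dom \<Delta> \<inter> dom \<Sigma>1 = {} \<and> dom \<Delta> \<inter> dom \<Sigma>2 = {} \<and> dom \<Sigma>1 \<inter> dom \<Sigma>2 = {} \<and>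
        \<Gamma> = \<Delta> ++ \<Sigma>1 ++ \<Sigma>2 \<and> \<Gamma>1 = \<Delta> ++ \<Sigma>1 \<and> \<Gamma>2 = \<Delta> ++ \<Sigma>2)"

definition fresh :: "name \<Rightarrow> mctx \<Rightarrow> main_term \<Rightarrow> bool" where
  "fresh x \<Gamma> M \<longleftrightarrow> x \<notin> dom \<Gamma> \<and> x \<notin> fv M"

inductive mtyped :: "mctx \<Rightarrow> main_term \<Rightarrow> mty \<Rightarrow> bool" where
  mt_star: "bang_ctx \<Delta> \<Longrightarrow> mtyped \<Delta> MStar TyI"
| mt_var: "\<lbrakk>bang_ctx \<Delta>; x \<notin> dom \<Delta>\<rbrakk> \<Longrightarrow> mtyped (\<Delta>(x \<mapsto> A)) (Free x) A"
| mt_inl: "mtyped \<Gamma> M A \<Longrightarrow> mtyped \<Gamma> (Inl M) (TyPlus A B)"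
| mt_inr: "mtyped \<Gamma> M B \<Longrightarrow> mtyped \<Gamma> (Inr M) (TyPlus A B)"
| mt_case:
    "\<lbrakk>split_ctx \<Gamma> \<Gamma>1 \<Gamma>2; mtyped \<Gamma>1 L (TyPlus A B);
      fresh x \<Gamma>2 M; mtyped (\<Gamma>2(x \<mapsto> A)) (inst M [Free x]) C;
      fresh y \<Gamma>2 N; mtyped (\<Gamma>2(y \<mapsto> B)) (inst N [Free y]) C\<rbrakk>
     \<Longrightarrow> mtyped \<Gamma> (Case L M N) C"
| mt_tens:
    "\<lbrakk>split_ctx \<Gamma> \<Gamma>1 \<Gamma>2; mtyped \<Gamma>1 M A; mtyped \<Gamma>2 N B\<rbrakk>
     \<Longrightarrow> mtyped \<Gamma> (Tens M N) (TyTens A B)"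
| mt_let_tens:
    "\<lbrakk>split_ctx \<Gamma> \<Gamma>1 \<Gamma>2; mtyped \<Gamma>1 M (TyTens A B);
      fresh x \<Gamma>2 N; fresh y \<Gamma>2 N; x \<noteq> y;
      mtyped (\<Gamma>2(x \<mapsto> A, y \<mapsto> B)) (inst N [Free x, Free y]) C\<rbrakk>
     \<Longrightarrow> mtyped \<Gamma> (LetTens M N) C"
| mt_lift: "\<lbrakk>bang_ctx \<Delta>; mtyped \<Delta> M A\<rbrakk> \<Longrightarrow> mtyped \<Delta> (Lift M) (TyBang A)"
| mt_force: "mtyped \<Gamma> M (TyBang A) \<Longrightarrow> mtyped \<Gamma> (Force M) A"
| mt_lam:
    "\<lbrakk>fresh x \<Gamma> M; mtyped (\<Gamma>(x \<mapsto> A)) (inst M [Free x]) B\<rbrakk>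
     \<Longrightarrow> mtyped \<Gamma> (Lam M) (TyLolli A B)"
| mt_app:
    "\<lbrakk>split_ctx \<Gamma> \<Gamma>1 \<Gamma>2; mtyped \<Gamma>1 M (TyLolli A B); mtyped \<Gamma>2 N A\<rbrakk>
     \<Longrightarrow> mtyped \<Gamma> (App M N) B"
| mt_zero: "bang_ctx \<Delta> \<Longrightarrow> mtyped \<Delta> Zero TyNat"
| mt_succ: "mtyped \<Gamma> M TyNat \<Longrightarrow> mtyped \<Gamma> (Succ M) TyNat"
| mt_match:
    "\<lbrakk>split_ctx \<Gamma> \<Gamma>1 \<Gamma>2; mtyped \<Gamma>1 L TyNat; mtyped \<Gamma>2 M A;
      fresh x \<Gamma>2 N; mtyped (\<Gamma>2(x \<mapsto> TyNat)) (inst N [Free x]) A\<rbrakk>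
     \<Longrightarrow> mtyped \<Gamma> (MatchNat L M N) A"
| mt_pure: "\<lbrakk>bang_ctx \<Delta>; qtyped Map.empty t Q\<rbrakk> \<Longrightarrow> mtyped \<Delta> (Pure t) (TyB Q)"
| mt_meas: "mtyped \<Gamma> M (TyB Q) \<Longrightarrow> mtyped \<Gamma> (Meas M) (classical_ty Q)"
| mt_apply:
    "\<lbrakk>utyped u Q1 Q2; mtyped \<Gamma> M (TyB Q1)\<rbrakk> \<Longrightarrow> mtyped \<Gamma> (ApplyU u M) (TyB Q2)"
| mt_gather:
    "\<lbrakk>split_ctx \<Gamma> \<Gamma>1 \<Gamma>2; mtyped \<Gamma>1 M (TyTens (TyB Q1) (TyB Q2));
      fresh z \<Gamma>2 N; mtyped (\<Gamma>2(z \<mapsto> TyB (QTens Q1 Q2))) (inst N [Free z]) A\<rbrakk>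
     \<Longrightarrow> mtyped \<Gamma> (LetGather M N) A"
| mt_divide:
    "\<lbrakk>split_ctx \<Gamma> \<Gamma>1 \<Gamma>2; mtyped \<Gamma>1 M (TyB (QTens Q1 Q2));
      fresh x \<Gamma>2 N; fresh y \<Gamma>2 N; x \<noteq> y;
      mtyped (\<Gamma>2(x \<mapsto> TyB Q1, y \<mapsto> TyB Q2)) (inst N [Free x, Free y]) A\<rbrakk>
     \<Longrightarrow> mtyped \<Gamma> (LetDivide M N) A"

subsection \<open>Configurations\<close>

text \<open>A configuration \<open>(t, u\<^sub>\<sigma>, xs, M)\<close> records explicitly which blocks of \<open>u\<^sub>\<sigma> t\<close> the variables
  represent: the \<open>i\<close>-th block belongs to \<open>xs ! i\<close>. Names in \<open>xs\<close> that do not occur in \<open>M\<close> are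
  placeholders for auxiliary blocks.\<close>

type_synonym config = "qterm \<times> unitary \<times> name list \<times> main_term"

primrec occurrences :: "'v mterm \<Rightarrow> 'v list" where
  "occurrences MStar = []"
| "occurrences (Free x) = [x]"
| "occurrences (Bound i) = []"
| "occurrences (Inl M) = occurrences M"
| "occurrences (Inr M) = occurrences M"
| "occurrences (Case L M N) = occurrences L @ occurrences M @ occurrences N"
| "occurrences (Tens M N) = occurrences M @ occurrences N"
| "occurrences (LetTens M N) = occurrences M @ occurrences N"
| "occurrences (Lift M) = occurrences M"
| "occurrences (Force M) = occurrences M"
| "occurrences (Lam M) = occurrences M"
| "occurrences (App M N) = occurrences M @ occurrences N"
| "occurrences Zero = []"
| "occurrences (Succ M) = occurrences M"
| "occurrences (MatchNat L M N) = occurrences L @ occurrences M @ occurrences N"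
| "occurrences (Pure t) = []"
| "occurrences (Meas M) = occurrences M"
| "occurrences (ApplyU u M) = occurrences M"
| "occurrences (LetGather M N) = occurrences M @ occurrences N"
| "occurrences (LetDivide M N) = occurrences M @ occurrences N"

text \<open>A variable may occur in several branches; its first occurrence counts.\<close>

definition vars_in_order :: "'v mterm \<Rightarrow> 'v list" where
  "vars_in_order M = rev (remdups (rev (occurrences M)))"

fun semi_value_config :: "basis rel \<Rightarrow> config \<Rightarrow> bool" where
  "semi_value_config r (t, u, xs, M) = is_qvalue r t"

text \<open>The type \<open>Q\<close> of \<open>t\<close> is arbitrary, so it can be any tensor product in any bracketing. The
  blocks \<open>Qs\<close> are those of the variables of \<open>M\<close>, the blocks \<open>Rs\<close> are auxiliary.\<close>

fun wf_config :: "config \<Rightarrow> mty \<Rightarrow> bool" where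
  "wf_config (t, u, xs, M) A \<longleftrightarrow>
     (\<exists>Q Qs Rs ys.
        qtyped Map.empty t Q \<and>
        is_perm u \<and> utyped u Q (qty_tensor (Qs @ Rs)) \<and>
        xs = vars_in_order M @ ys \<and> distinct xs \<and>
        length Qs = length (vars_in_order M) \<and> length Rs = length ys \<and>
        mtyped (map_of (zip (vars_in_order M) (map TyB Qs))) M A)"

text \<open>Two permutations with listings of the blocks are identified if they link every variable to the
  same component of \<open>t\<close>: every basis vector is sent to the same block contents \<open>c\<close>, up to the order
  in which the blocks are listed. For \<open>xs = xs'\<close> this says that \<open>u\<close> and \<open>u'\<close> denote the same
  isomorphism.\<close>

definition same_link :: "qterm \<Rightarrow> unitary \<Rightarrow> name list \<Rightarrow> unitary \<Rightarrow> name list \<Rightarrow> bool" where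
  "same_link t u xs u' xs' \<longleftrightarrow>
     is_perm u \<and> is_perm u' \<and> distinct xs \<and> distinct xs' \<and> set xs = set xs' \<and>
     (\<exists>Q Qs Qs'. qtyped Map.empty t Q \<and>
        length Qs = length xs \<and> utyped u Q (qty_tensor Qs) \<and>
        length Qs' = length xs' \<and> utyped u' Q (qty_tensor Qs') \<and>
        (\<forall>b. qtyped Map.empty (term_of_basis b) Q \<longrightarrow>
           (\<exists>c. perm_maps u b (basis_tensor (map c xs)) \<and>
                perm_maps u' b (basis_tensor (map c xs')))))"

text \<open>\<open>relinks \<sigma> zs ys\<close>: the permutation \<open>\<sigma>\<close> moves the blocks listed by \<open>zs\<close> into the order \<open>ys\<close>.\<close>

definition relinks :: "unitary \<Rightarrow> name list \<Rightarrow> name list \<Rightarrow> bool" where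
  "relinks \<sigma> zs ys \<longleftrightarrow>
     is_perm \<sigma> \<and> distinct zs \<and> distinct ys \<and> set zs = set ys \<and>
     (\<forall>c. perm_maps \<sigma> (basis_tensor (map c zs)) (basis_tensor (map c ys)))"

subsection \<open>Evaluation contexts\<close>

datatype (ctx_fv: 'v) ectx =
    Hole
  | CTensL "'v ectx" "'v mterm"
  | CTensR "'v mterm" "'v ectx"
  | CLetTens "'v ectx" "'v mterm"
  | CInl "'v ectx"
  | CInr "'v ectx"
  | CCase "'v ectx" "'v mterm" "'v mterm"
  | CForce "'v ectx"
  | CSucc "'v ectx"
  | CMatchNat "'v ectx" "'v mterm" "'v mterm"
  | CAppL "'v ectx" "'v mterm"
  | CAppR "'v mterm" "'v ectx"
  | CMeas "'v ectx"
  | CApplyU unitary "'v ectx"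
  | CLetGather "'v ectx" "'v mterm"
  | CLetDivide "'v ectx" "'v mterm"

primrec eval_ctx :: "'v ectx \<Rightarrow> bool" where
  "eval_ctx Hole = True"
| "eval_ctx (CTensL E N) = eval_ctx E"
| "eval_ctx (CTensR V E) = (is_value V \<and> eval_ctx E)"
| "eval_ctx (CLetTens E N) = eval_ctx E"
| "eval_ctx (CInl E) = eval_ctx E"
| "eval_ctx (CInr E) = eval_ctx E"
| "eval_ctx (CCase E M N) = eval_ctx E"
| "eval_ctx (CForce E) = eval_ctx E"
| "eval_ctx (CSucc E) = eval_ctx E"
| "eval_ctx (CMatchNat E M N) = eval_ctx E"
| "eval_ctx (CAppL E N) = eval_ctx E"
| "eval_ctx (CAppR V E) = (is_value V \<and> eval_ctx E)"
| "eval_ctx (CMeas E) = eval_ctx E"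
| "eval_ctx (CApplyU u E) = eval_ctx E"
| "eval_ctx (CLetGather E N) = eval_ctx E"
| "eval_ctx (CLetDivide E N) = eval_ctx E"

primrec plug :: "'v ectx \<Rightarrow> 'v mterm \<Rightarrow> 'v mterm" where
  "plug Hole L = L"
| "plug (CTensL E N) L = Tens (plug E L) N"
| "plug (CTensR V E) L = Tens V (plug E L)"
| "plug (CLetTens E N) L = LetTens (plug E L) N"
| "plug (CInl E) L = Inl (plug E L)"
| "plug (CInr E) L = Inr (plug E L)"
| "plug (CCase E M N) L = Case (plug E L) M N"
| "plug (CForce E) L = Force (plug E L)"
| "plug (CSucc E) L = Succ (plug E L)"
| "plug (CMatchNat E M N) L = MatchNat (plug E L) M N"
| "plug (CAppL E N) L = App (plug E L) N"
| "plug (CAppR V E) L = App V (plug E L)"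
| "plug (CMeas E) L = Meas (plug E L)"
| "plug (CApplyU u E) L = ApplyU u (plug E L)"
| "plug (CLetGather E N) L = LetGather (plug E L) N"
| "plug (CLetDivide E N) L = LetDivide (plug E L) N"

subsection \<open>Small-step semantics\<close>

inductive classical_step :: "'v mterm \<Rightarrow> 'v mterm \<Rightarrow> bool" where
  "is_value V \<Longrightarrow> classical_step (Case (Inl V) M N) (inst M [V])"
| "is_value V \<Longrightarrow> classical_step (Case (Inr V) M N) (inst N [V])"
| "\<lbrakk>is_value V; is_value W\<rbrakk> \<Longrightarrow> classical_step (LetTens (Tens V W) M) (inst M [V, W])"
| "classical_step (Force (Lift M)) M"
| "is_value V \<Longrightarrow> classical_step (App (Lam M) V) (inst M [V])"
| "classical_step (MatchNat Zero M N) M"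
| "is_value V \<Longrightarrow> classical_step (MatchNat (Succ V) M N) (inst N [V])"

text \<open>In \<open>step_meas\<close> the list \<open>ds\<close> contains, for every \<open>i\<close>, the triple of \<open>p\<^sub>i\<close>, \<open>b\<^sub>i\<close> and the list of
  all \<open>(\<alpha>\<^sub>i\<^sub>j, c\<^sub>i\<^sub>j, r\<^sub>i\<^sub>j)\<close>, where \<open>c\<^sub>i\<^sub>j\<close> is the basis vector of \<open>t\<close> that the permutation
  sends to \<open>b\<^sub>i \<otimes> r\<^sub>i\<^sub>j\<close>. If \<open>c\<^sub>i\<^sub>j\<close> is \<open>b'\<^sub>i\<^sub>j \<otimes> \<dots> \<otimes> b\<^sub>i \<otimes> \<dots> \<otimes> b''\<^sub>i\<^sub>j\<close>, with \<open>b\<^sub>i\<close> in position \<open>s\<close>, and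
  the permutation moves position \<open>s\<close> to the front, then \<open>r\<^sub>i\<^sub>j\<close> is \<open>b'\<^sub>i\<^sub>j \<otimes> \<dots> \<otimes> b''\<^sub>i\<^sub>j\<close>.
  This form makes sense for every bracketing of the tensors and for merged blocks.

  In \<open>step_ctx\<close> the blocks of the variables of \<open>E\<close> are among the auxiliary blocks \<open>zs\<close> of the
  premise, and \<open>\<sigma>\<close> acts on auxiliary blocks only. Rule \<open>step_link\<close> works modulo the identification
  of permutations.\<close>

inductive step :: "config \<Rightarrow> real \<Rightarrow> config \<Rightarrow> bool" where
  step_classical:
    "classical_step M M' \<Longrightarrow> step (t, u, xs, M) 1 (t, u, xs, M')"
| step_pure:
    "x \<notin> set xs
     \<Longrightarrow> step (t, u, xs, Pure t') 1 (TTens t t', UComp u_swap (UTens u u_id), x # xs, Free x)"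
| step_meas:
    "\<lbrakk>t = TSum (map (\<lambda>(p, b, l).
            (complex_of_real p, TSum (map (\<lambda>(\<alpha>, c, r). (\<alpha>, term_of_basis c)) l))) ds);
      is_perm u;
      \<forall>(p, b, l) \<in> set ds. p > 0 \<and> closed_basis b \<and>
        (\<forall>(\<alpha>, c, r) \<in> set l. perm_maps u c (BTens b r));
      distinct (map (\<lambda>(p, b, l). b) ds);
      (p\<^sub>k, b\<^sub>k, l\<^sub>k) \<in> set ds\<rbrakk>
     \<Longrightarrow> step (t, u, x # xs, Meas (Free x)) (\<bar>p\<^sub>k\<bar>\<^sup>2)
           (TSum (map (\<lambda>(\<alpha>, c, r). (\<alpha>, term_of_basis r)) l\<^sub>k), u_id, xs, classical b\<^sub>k)"
| step_apply:
    "step (t, u\<^sub>\<sigma>, z # xs, ApplyU u (Free z)) 1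
       (TApp (UComp (UDag u\<^sub>\<sigma>) (UComp (UTens u u_id) u\<^sub>\<sigma>)) t, u\<^sub>\<sigma>, z # xs, Free z)"
| step_gather:
    "z \<notin> fv N \<union> set (x # y # xs)
     \<Longrightarrow> step (t, u, x # y # xs, LetGather (Tens (Free x) (Free y)) N) 1
           (t, UComp u_gather u, z # xs, inst N [Free z])"
| step_divide:
    "\<lbrakk>x \<noteq> y; x \<notin> fv N \<union> set (z # xs); y \<notin> fv N \<union> set (z # xs)\<rbrakk>
     \<Longrightarrow> step (t, u, z # xs, LetDivide (Free z) N) 1
           (t, UComp u_divide u, x # y # xs, inst N [Free x, Free y])"
| step_ctx:
    "\<lbrakk>step (t1, u1, xs1 @ zs, M1) p (t2, u2, xs2 @ zs, M2);
      set xs1 = fv M1; distinct (xs1 @ zs); set xs2 = fv M2; distinct (xs2 @ zs);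
      eval_ctx E; ctx_fv E \<subseteq> set zs; relinks \<sigma> zs ys\<rbrakk>
     \<Longrightarrow> step (t1, UComp (u_ext (length xs1) \<sigma>) u1, xs1 @ ys, plug E M1) p
              (t2, UComp (u_ext (length xs2) \<sigma>) u2, xs2 @ ys, plug E M2)"
| step_link:
    "\<lbrakk>same_link t1 u1 xs1 u1' xs1'; step (t1, u1', xs1', M1) p (t2, u2', xs2', M2);
      same_link t2 u2' xs2' u2 xs2\<rbrakk>
     \<Longrightarrow> step (t1, u1, xs1, M1) p (t2, u2, xs2, M2)"

fun rename_config :: "(name \<Rightarrow> name) \<Rightarrow> config \<Rightarrow> config" where
  "rename_config \<rho> (t, u, xs, M) = (t, u, map \<rho> xs, rename \<rho> M)"

text \<open>The renamings \<open>\<rho>\<close>, \<open>\<rho>'\<close> are there because configurations are taken up to renaming of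
  variables.\<close>

inductive reduces :: "basis rel \<Rightarrow> config \<Rightarrow> real \<Rightarrow> config \<Rightarrow> bool" for r where
  "\<lbrakk>bij \<rho>; C = rename_config \<rho> (v, u, xs, M);
    is_qvalue r v; qeq r Map.empty v t Q;
    step (t, u, xs, M) p (t', u', xs', M');
    qeq r Map.empty t' v' Q'; is_qvalue r v';
    bij \<rho>'; C' = rename_config \<rho>' (v', u', xs', M')\<rbrakk>
   \<Longrightarrow> reduces r C p C'"

end

theory Submission
  imports Defs
begin

text \<open>Only the main-calculus term of a configuration matters. Replacing all its variables by a single
  one makes renamings disappear, and every reduction becomes a step of a nondeterministic
  call-by-value calculus in which a measurement may yield any closed basis value. Strong
  normalisation of that calculus follows from reducibility predicates which constrain a value only if
  it has the shape its type demands. Variables and classical basis values are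
  therefore reducible at every type, so that no preservation of quantum types is needed, and
  linearity plays no role either.\<close>

section \<open>Erased reduction\<close>

text \<open>The names \<open>x\<close>, \<open>y\<close>, \<open>z\<close> produced by the quantum
  rules are arbitrary rather than fresh: freshness would be lost when all variables are
  identified.\<close>

inductive mstep :: "'v mterm \<Rightarrow> 'v mterm \<Rightarrow> bool" where
  mstep_classical: "classical_step M M' \<Longrightarrow> mstep M M'"
| mstep_pure: "mstep (Pure t) (Free x)"
| mstep_meas: "closed_basis b \<Longrightarrow> mstep (Meas (Free x)) (classical b)"
| mstep_apply: "mstep (ApplyU u (Free z)) (Free z)"
| mstep_gather: "mstep (LetGather (Tens (Free x) (Free y)) N) (inst N [Free z])"
| mstep_divide: "mstep (LetDivide (Free z) N) (inst N [Free x, Free y])"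
| "mstep M M' \<Longrightarrow> mstep (Tens M N) (Tens M' N)"
| "\<lbrakk>is_value V; mstep M M'\<rbrakk> \<Longrightarrow> mstep (Tens V M) (Tens V M')"
| "mstep M M' \<Longrightarrow> mstep (LetTens M N) (LetTens M' N)"
| "mstep M M' \<Longrightarrow> mstep (Inl M) (Inl M')"
| "mstep M M' \<Longrightarrow> mstep (Inr M) (Inr M')"
| "mstep L L' \<Longrightarrow> mstep (Case L M N) (Case L' M N)"
| "mstep M M' \<Longrightarrow> mstep (Force M) (Force M')"
| "mstep M M' \<Longrightarrow> mstep (Succ M) (Succ M')"
| "mstep L L' \<Longrightarrow> mstep (MatchNat L M N) (MatchNat L' M N)"
| "mstep M M' \<Longrightarrow> mstep (App M N) (App M' N)"
| "\<lbrakk>is_value V; mstep M M'\<rbrakk> \<Longrightarrow> mstep (App V M) (App V M')"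
| "mstep M M' \<Longrightarrow> mstep (Meas M) (Meas M')"
| "mstep M M' \<Longrightarrow> mstep (ApplyU u M) (ApplyU u M')"
| "mstep M M' \<Longrightarrow> mstep (LetGather M N) (LetGather M' N)"
| "mstep M M' \<Longrightarrow> mstep (LetDivide M N) (LetDivide M' N)"

inductive_cases mstep_elims:
  "mstep MStar N" "mstep (Free x) N" "mstep (Inl M) N" "mstep (Inr M) N" "mstep (Case L M M') N"
  "mstep (Tens M M') N" "mstep (LetTens M M') N" "mstep (Lift M) N" "mstep (Force M) N"
  "mstep (Lam M) N" "mstep (App M M') N" "mstep Zero N" "mstep (Succ M) N"
  "mstep (MatchNat L M M') N" "mstep (Pure t) N" "mstep (Meas M) N" "mstep (ApplyU u M) N"
  "mstep (LetGather M M') N" "mstep (LetDivide M M') N"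

inductive_cases classical_step_elims:
  "classical_step MStar N" "classical_step (Free x) N" "classical_step (Inl M) N"
  "classical_step (Inr M) N" "classical_step (Case L M M') N" "classical_step (Tens M M') N"
  "classical_step (LetTens M M') N" "classical_step (Lift M) N" "classical_step (Force M) N"
  "classical_step (Lam M) N" "classical_step (App M M') N" "classical_step Zero N"
  "classical_step (Succ M) N" "classical_step (MatchNat L M M') N" "classical_step (Pure t) N"
  "classical_step (Meas M) N" "classical_step (ApplyU u M) N" "classical_step (LetGather M M') N"
  "classical_step (LetDivide M M') N"

lemmas mstep_inversion = mstep_elims classical_step_elims

lemma mstep_plug: "\<lbrakk>mstep M M'; eval_ctx E\<rbrakk> \<Longrightarrow> mstep (plug E M) (plug E M')"
  by (induction E) (auto intro: mstep.intros)

text \<open>Value formers have only congruence rules, and no rule acts below \<open>Lift\<close> or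
  \<open>Lam\<close>.\<close>

lemma is_value_no_step: "\<lbrakk>is_value V; mstep V M\<rbrakk> \<Longrightarrow> False"
  by (induction V arbitrary: M) (auto elim!: mstep_inversion)

lemma is_value_classical: "closed_basis b \<Longrightarrow> is_value (classical b)"
  by (induction b) auto

section \<open>Invariance of reduction under renaming\<close>

lemma is_value_rename [simp]: "is_value (rename f M) = is_value M"
  by (induction M) auto

lemma rename_classical: "closed_basis b \<Longrightarrow> rename f (classical b) = classical b"
  by (induction b) auto

lemma rename_subst_bound:
  "rename f (subst_bound k Vs M) = subst_bound k (map (rename f) Vs) (rename f M)"
  by (induction M arbitrary: k) auto

lemma classical_step_rename:
  "classical_step M M' \<Longrightarrow> classical_step (rename f M) (rename f M')"
  by (induction rule: classical_step.induct)
    (auto simp: rename_subst_bound intro: classical_step.intros)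

text \<open>No rule of \<open>mstep\<close> compares names, so \<open>f\<close> may identify
  variables.\<close>

lemma mstep_rename: "mstep M M' \<Longrightarrow> mstep (rename f M) (rename f M')"
  by (induction rule: mstep.induct)
    (auto simp: rename_subst_bound rename_classical intro: mstep.intros classical_step_rename)

section \<open>Passage from configurations to erased terms\<close>

fun main_term :: "config \<Rightarrow> main_term" where
  "main_term (t, u, xs, M) = M"

abbreviation erase :: "config \<Rightarrow> unit mterm" where
  "erase C \<equiv> rename (\<lambda>_. ()) (main_term C)"

text \<open>\<open>step_ctx\<close> turns into congruence rules via \<open>mstep_plug\<close>;
  \<open>step_link\<close> leaves the main term unchanged, so its case is the induction
  hypothesis.\<close>

lemma step_mstep: "step C p C' \<Longrightarrow> mstep (main_term C) (main_term C')"
  by (induction rule: step.induct) (auto intro: mstep.intros mstep_plug)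

text \<open>The equational theory touches only the quantum term, and renamings become invisible once
  all names coincide.\<close>

lemma reduces_mstep_erase: "reduces r C p C' \<Longrightarrow> mstep (erase C) (erase C')"
  by (erule reduces.cases) (auto simp: mterm.map_comp comp_def dest!: step_mstep mstep_rename)

section \<open>Local closure and substitution for free variables\<close>

primrec closed_below :: "nat \<Rightarrow> 'v mterm \<Rightarrow> bool" where
  "closed_below k MStar = True"
| "closed_below k (Free x) = True"
| "closed_below k (Bound i) = (i < k)"
| "closed_below k (Inl M) = closed_below k M"
| "closed_below k (Inr M) = closed_below k M"
| "closed_below k (Case L M N) =
     (closed_below k L \<and> closed_below (k + 1) M \<and> closed_below (k + 1) N)"
| "closed_below k (Tens M N) = (closed_below k M \<and> closed_below k N)"
| "closed_below k (LetTens M N) = (closed_below k M \<and> closed_below (k + 2) N)"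
| "closed_below k (Lift M) = closed_below k M"
| "closed_below k (Force M) = closed_below k M"
| "closed_below k (Lam M) = closed_below (k + 1) M"
| "closed_below k (App M N) = (closed_below k M \<and> closed_below k N)"
| "closed_below k Zero = True"
| "closed_below k (Succ M) = closed_below k M"
| "closed_below k (MatchNat L M N) =
     (closed_below k L \<and> closed_below k M \<and> closed_below (k + 1) N)"
| "closed_below k (Pure t) = True"
| "closed_below k (Meas M) = closed_below k M"
| "closed_below k (ApplyU u M) = closed_below k M"
| "closed_below k (LetGather M N) = (closed_below k M \<and> closed_below (k + 1) N)"
| "closed_below k (LetDivide M N) = (closed_below k M \<and> closed_below (k + 2) N)"

abbreviation locally_closed :: "'v mterm \<Rightarrow> bool" where
  "locally_closed \<equiv> closed_below 0"

lemma closed_below_mono: "\<lbrakk>closed_below k M; k \<le> l\<rbrakk> \<Longrightarrow> closed_below l M"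
  by (induction M arbitrary: k l) fastforce+

lemma subst_bound_closed_below: "closed_below k M \<Longrightarrow> subst_bound k Vs M = M"
  by (induction M arbitrary: k) auto

lemma closed_below_subst_bound:
  "\<lbrakk>closed_below (k + length Vs) M; \<forall>V \<in> set Vs. locally_closed V\<rbrakk>
   \<Longrightarrow> closed_below k (subst_bound k Vs M)"
  by (induction M arbitrary: k) (auto intro: closed_below_mono)

text \<open>Typing rules mention a body only after opening it with fresh names; this recovers
  closure of the body itself.\<close>

lemma closed_below_subst_boundD:
  "closed_below k (subst_bound k Vs M) \<Longrightarrow> closed_below (k + length Vs) M"
  by (induction M arbitrary: k) (fastforce split: if_splits)+

lemma closed_below_classical: "closed_basis b \<Longrightarrow> closed_below k (classical b)"
  by (induction b) auto

lemma mstep_locally_closed: "\<lbrakk>mstep M M'; locally_closed M\<rbrakk> \<Longrightarrow> locally_closed M'"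
proof (induction rule: mstep.induct)
  case (mstep_classical M M')
  then show ?case
    by (induction rule: classical_step.induct) (auto intro!: closed_below_subst_bound)
qed (auto intro!: closed_below_subst_bound closed_below_classical)

lemma mtyped_locally_closed: "mtyped \<Gamma> M A \<Longrightarrow> locally_closed M"
  by (induction rule: mtyped.induct) (auto dest: closed_below_subst_boundD)

section \<open>Simultaneous substitution for free variables\<close>

text \<open>No shifting takes place below binders, since only locally closed terms are substituted.
  Source and target names may differ, so that erasure is a special case.\<close>

primrec msubst :: "('v \<Rightarrow> 'w mterm) \<Rightarrow> 'v mterm \<Rightarrow> 'w mterm" where
  "msubst \<theta> MStar = MStar"
| "msubst \<theta> (Free x) = \<theta> x"
| "msubst \<theta> (Bound i) = Bound i"
| "msubst \<theta> (Inl M) = Inl (msubst \<theta> M)"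
| "msubst \<theta> (Inr M) = Inr (msubst \<theta> M)"
| "msubst \<theta> (Case L M N) = Case (msubst \<theta> L) (msubst \<theta> M) (msubst \<theta> N)"
| "msubst \<theta> (Tens M N) = Tens (msubst \<theta> M) (msubst \<theta> N)"
| "msubst \<theta> (LetTens M N) = LetTens (msubst \<theta> M) (msubst \<theta> N)"
| "msubst \<theta> (Lift M) = Lift (msubst \<theta> M)"
| "msubst \<theta> (Force M) = Force (msubst \<theta> M)"
| "msubst \<theta> (Lam M) = Lam (msubst \<theta> M)"
| "msubst \<theta> (App M N) = App (msubst \<theta> M) (msubst \<theta> N)"
| "msubst \<theta> Zero = Zero"
| "msubst \<theta> (Succ M) = Succ (msubst \<theta> M)"
| "msubst \<theta> (MatchNat L M N) = MatchNat (msubst \<theta> L) (msubst \<theta> M) (msubst \<theta> N)"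
| "msubst \<theta> (Pure t) = Pure t"
| "msubst \<theta> (Meas M) = Meas (msubst \<theta> M)"
| "msubst \<theta> (ApplyU u M) = ApplyU u (msubst \<theta> M)"
| "msubst \<theta> (LetGather M N) = LetGather (msubst \<theta> M) (msubst \<theta> N)"
| "msubst \<theta> (LetDivide M N) = LetDivide (msubst \<theta> M) (msubst \<theta> N)"

lemma msubst_cong: "(\<And>x. x \<in> fv M \<Longrightarrow> \<theta> x = \<theta>' x) \<Longrightarrow> msubst \<theta> M = msubst \<theta>' M"
  by (induction M) auto

lemma msubst_Free: "msubst (\<lambda>x. Free (f x)) M = rename f M"
  by (induction M) auto

lemma msubst_subst_bound:
  assumes "\<And>x. locally_closed (\<theta> x)"
  shows "msubst \<theta> (subst_bound k Vs M) = subst_bound k (map (msubst \<theta>) Vs) (msubst \<theta> M)"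
  using assms
  by (induction M arbitrary: k)
    (auto simp: subst_bound_closed_below closed_below_mono[of 0])

lemma closed_below_msubst:
  "\<lbrakk>closed_below k M; \<And>x. locally_closed (\<theta> x)\<rbrakk> \<Longrightarrow> closed_below k (msubst \<theta> M)"
  by (induction M arbitrary: k) (auto intro: closed_below_mono[of 0])

text \<open>A reduction instantiates a body with a value, while typing opens it with a fresh name.
  Extending \<theta> at that name reconciles the two.\<close>

lemma inst_msubst_fresh:
  assumes "\<And>y. locally_closed (\<theta> y)" "locally_closed V" "x \<notin> fv M"
  shows "inst (msubst \<theta> M) [V] = msubst (\<theta>(x := V)) (inst M [Free x])"
proof -
  have "msubst \<theta> M = msubst (\<theta>(x := V)) M"
    using assms(3) by (intro msubst_cong) auto
  then show ?thesis using assms by (simp add: msubst_subst_bound)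
qed

lemma inst_msubst_fresh2:
  assumes "\<And>y. locally_closed (\<theta> y)" "locally_closed V" "locally_closed W"
    "x \<notin> fv M" "y \<notin> fv M" "x \<noteq> y"
  shows "inst (msubst \<theta> M) [V, W] = msubst (\<theta>(x := V, y := W)) (inst M [Free x, Free y])"
proof -
  have "msubst \<theta> M = msubst (\<theta>(x := V, y := W)) M"
    using assms(4,5) by (intro msubst_cong) auto
  then show ?thesis using assms by (simp add: msubst_subst_bound)
qed

section \<open>Reducibility\<close>

text \<open>As an inductive predicate, \<open>computes S M\<close> says that \<open>M\<close> is strongly normalising and that all
  values it reduces to satisfy \<open>S\<close>.\<close>

inductive computes :: "('v mterm \<Rightarrow> bool) \<Rightarrow> 'v mterm \<Rightarrow> bool" for S where
  computesI: "\<lbrakk>is_value M \<Longrightarrow> S M; \<And>M'. mstep M M' \<Longrightarrow> computes S M'\<rbrakk> \<Longrightarrow> computes S M"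

lemma computes_value: "\<lbrakk>is_value V; S V\<rbrakk> \<Longrightarrow> computes S V"
  by (auto intro: computesI dest: is_value_no_step)

text \<open>The tail of an infinite sequence from \<open>M\<close> starts at a reduct of
  \<open>M\<close>, to which the induction hypothesis applies.\<close>

lemma computes_no_infinite_sequence:
  "\<lbrakk>computes S M; f 0 = M\<rbrakk> \<Longrightarrow> \<exists>n. \<not> mstep (f n) (f (Suc n))"
proof (induction arbitrary: f rule: computes.induct)
  case (computesI M)
  show ?case
  proof (rule ccontr)
    assume steps: "\<not> ?thesis"
    then have "mstep M (f (Suc 0))" using computesI.prems by metis
    then show False using computesI.IH[of _ "\<lambda>n. f (Suc n)"] steps by auto
  qed
qed

section \<open>Evaluation inside a frame\<close>

text \<open>One layer of an evaluation context, described by its behaviour: while the hole holds a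
  non-value, every reduction happens inside the hole.\<close>

definition frame :: "('v mterm \<Rightarrow> 'v mterm) \<Rightarrow> bool" where
  "frame F \<longleftrightarrow> (\<forall>M. \<not> is_value M \<longrightarrow>
     \<not> is_value (F M) \<and> (\<forall>N. mstep (F M) N \<longrightarrow> (\<exists>M'. mstep M M' \<and> N = F M')))"

text \<open>A redex at the root needs a value in the hole. Right-hand holes have a value
  \<open>V\<close> on their left, which cannot step.\<close>

lemma frames:
  "frame Inl" "frame Inr" "frame Succ" "frame Force" "frame Meas" "frame (ApplyU u)"
  "frame (\<lambda>L. Case L M N)" "frame (\<lambda>M. Tens M N)" "is_value V \<Longrightarrow> frame (Tens V)"
  "frame (\<lambda>M. LetTens M N)" "frame (\<lambda>L. MatchNat L M N)" "frame (\<lambda>M. App M N)"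
  "is_value V \<Longrightarrow> frame (App V)" "frame (\<lambda>M. LetGather M N)" "frame (\<lambda>M. LetDivide M N)"
  by (auto simp: frame_def dest: is_value_no_step elim!: mstep_inversion)

text \<open>As long as \<open>M\<close> is no value, \<open>F M\<close> is no value either and its
  reducts are of the form \<open>F M'\<close>, covered by the induction hypothesis. Once a value is
  reached, \<open>on_values\<close> takes over.\<close>

lemma computes_frame:
  assumes "frame F" "computes S M" "locally_closed M"
    and on_values: "\<And>V. \<lbrakk>is_value V; locally_closed V; S V\<rbrakk> \<Longrightarrow> computes T (F V)"
  shows "computes T (F M)"
  using assms(2,3)
proof (induction rule: computes.induct)
  case (computesI M)
  show ?case
  proof (cases "is_value M")
    case True
    with computesI on_values show ?thesis by blast
  next
    case False
    show ?thesis
      using False computesI \<open>frame F\<close> unfolding frame_def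
      by (metis computes.computesI mstep_locally_closed)
  qed
qed

text \<open>The recursion is on the type, so the negative occurrence of \<open>reducible A\<close>
  in the arrow clause is harmless. \<open>TyNat\<close> is unconstrained because
  \<open>MatchNat\<close> is not recursive, and \<open>TyB\<close> because the quantum eliminators
  introduce only variables and classical basis values.\<close>

primrec reducible :: "mty \<Rightarrow> 'v mterm \<Rightarrow> bool" where
  "reducible TyI V = True"
| "reducible (TyPlus A B) V =
     ((\<forall>W. V = Inl W \<longrightarrow> reducible A W) \<and> (\<forall>W. V = Inr W \<longrightarrow> reducible B W))"
| "reducible (TyTens A B) V = (\<forall>W W'. V = Tens W W' \<longrightarrow> reducible A W \<and> reducible B W')"
| "reducible (TyBang A) V = (\<forall>M. V = Lift M \<longrightarrow> computes (reducible A) M)"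
| "reducible (TyLolli A B) V = (\<forall>M W. V = Lam M \<longrightarrow> is_value W \<longrightarrow> locally_closed W \<longrightarrow>
     reducible A W \<longrightarrow> computes (reducible B) (inst M [W]))"
| "reducible TyNat V = True"
| "reducible (TyB Q) V = True"

lemma reducible_Free: "reducible A (Free x)"
  by (cases A) auto

text \<open>No \<open>Lift\<close> or \<open>Lam\<close> occurs, so only the clauses for sums and
  products have content, and they pass to smaller classical values; where shape and type disagree
  the clause is vacuous.\<close>

lemma reducible_classical: "closed_basis b \<Longrightarrow> reducible A (classical b)"
  by (induction b arbitrary: A; case_tac A) auto

section \<open>Elimination of reducible values\<close>

text \<open>If \<open>V\<close> is an injection, its content is reducible and a branch takes over.
  Otherwise the term is stuck without being a value, and the claim is vacuous. The other eliminators
  follow the same pattern.\<close>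

lemma computes_Case:
  assumes "is_value V" "locally_closed V" "reducible (TyPlus A B) V"
    and "\<And>W. \<lbrakk>is_value W; locally_closed W; reducible A W\<rbrakk> \<Longrightarrow> computes S (inst M [W])"
    and "\<And>W. \<lbrakk>is_value W; locally_closed W; reducible B W\<rbrakk> \<Longrightarrow> computes S (inst N [W])"
  shows "computes S (Case V M N)"
  by (rule computesI) (use assms in \<open>auto dest: is_value_no_step elim!: mstep_inversion\<close>)

lemma computes_LetTens:
  assumes "is_value V" "locally_closed V" "reducible (TyTens A B) V"
    and "\<And>W W'. \<lbrakk>is_value W; locally_closed W; reducible A W;
      is_value W'; locally_closed W'; reducible B W'\<rbrakk> \<Longrightarrow> computes S (inst N [W, W'])"
  shows "computes S (LetTens V N)"
  by (rule computesI) (use assms in \<open>auto dest: is_value_no_step elim!: mstep_inversion\<close>)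

lemma computes_Force:
  assumes "is_value V" "reducible (TyBang A) V"
  shows "computes (reducible A) (Force V)"
  by (rule computesI) (use assms in \<open>auto dest: is_value_no_step elim!: mstep_inversion\<close>)

lemma computes_App:
  assumes "is_value V" "reducible (TyLolli A B) V" "is_value W" "locally_closed W" "reducible A W"
  shows "computes (reducible B) (App V W)"
  by (rule computesI) (use assms in \<open>auto dest: is_value_no_step elim!: mstep_inversion\<close>)

lemma computes_MatchNat:
  assumes "is_value V" "locally_closed V" "computes S M"
    and "\<And>W. \<lbrakk>is_value W; locally_closed W\<rbrakk> \<Longrightarrow> computes S (inst N [W])"
  shows "computes S (MatchNat V M N)"
  by (rule computesI) (use assms in \<open>auto dest: is_value_no_step elim!: mstep_inversion\<close>)

lemma computes_Pure: "computes (reducible A) (Pure t)"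
  by (rule computesI) (auto intro!: computes_value reducible_Free elim!: mstep_inversion)

lemma computes_Meas:
  assumes "is_value V"
  shows "computes (reducible A) (Meas V)"
  by (rule computesI)
    (use assms in \<open>auto intro!: computes_value reducible_classical is_value_classical
      dest: is_value_no_step elim!: mstep_inversion\<close>)

lemma computes_ApplyU:
  assumes "is_value V"
  shows "computes (reducible A) (ApplyU u V)"
  by (rule computesI)
    (use assms in \<open>auto intro!: computes_value reducible_Free
      dest: is_value_no_step elim!: mstep_inversion\<close>)

text \<open>All names \<open>x\<close> are considered because \<open>mstep\<close> leaves the new
  name open.\<close>

lemma computes_LetGather:
  assumes "is_value V" "\<And>x. computes S (inst N [Free x])"
  shows "computes S (LetGather V N)"
  by (rule computesI) (use assms in \<open>auto dest: is_value_no_step elim!: mstep_inversion\<close>)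

lemma computes_LetDivide:
  assumes "is_value V" "\<And>x y. computes S (inst N [Free x, Free y])"
  shows "computes S (LetDivide V N)"
  by (rule computesI) (use assms in \<open>auto dest: is_value_no_step elim!: mstep_inversion\<close>)

section \<open>Typed terms are reducible\<close>

text \<open>Closure is required at every name because commutation of \<theta> with
  \<open>subst_bound\<close> needs it everywhere; types constrain only the names in
  \<Gamma>.\<close>

definition reducible_subst :: "mctx \<Rightarrow> (name \<Rightarrow> 'v mterm) \<Rightarrow> bool" where
  "reducible_subst \<Gamma> \<theta> \<longleftrightarrow> (\<forall>x. is_value (\<theta> x) \<and> locally_closed (\<theta> x)) \<and>
     (\<forall>x A. \<Gamma> x = Some A \<longrightarrow> reducible A (\<theta> x))"

lemma reducible_subst_locally_closed: "reducible_subst \<Gamma> \<theta> \<Longrightarrow> locally_closed (\<theta> x)"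
  by (simp add: reducible_subst_def)

lemma reducible_subst_upd:
  "\<lbrakk>reducible_subst \<Gamma> \<theta>; is_value V; locally_closed V; reducible A V\<rbrakk>
   \<Longrightarrow> reducible_subst (\<Gamma>(x \<mapsto> A)) (\<theta>(x := V))"
  by (simp add: reducible_subst_def)

lemma split_ctx_le:
  assumes "split_ctx \<Gamma> \<Gamma>1 \<Gamma>2"
  shows "\<Gamma>1 \<subseteq>\<^sub>m \<Gamma>" "\<Gamma>2 \<subseteq>\<^sub>m \<Gamma>"
  using assms unfolding split_ctx_def map_le_def map_add_def dom_def
  by (fastforce split: option.splits)+

text \<open>Both parts are restrictions of \<Gamma>, so the same \<theta> serves both premises of a
  rule that splits its context.\<close>

lemma reducible_subst_split:
  assumes "split_ctx \<Gamma> \<Gamma>1 \<Gamma>2" "reducible_subst \<Gamma> \<theta>"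
  shows "reducible_subst \<Gamma>1 \<theta>" "reducible_subst \<Gamma>2 \<theta>"
  using split_ctx_le[OF assms(1)] assms(2) unfolding reducible_subst_def map_le_def dom_def
  by fastforce+

text \<open>The hypothesis on the opened body, in the form of an induction hypothesis for typing, is
  applied to \<theta> extended by \<open>V\<close> at \<open>x\<close>.\<close>

lemma computes_inst:
  assumes "reducible_subst \<Gamma> \<theta>" "fresh x \<Gamma> M"
    and "\<And>\<theta>'. reducible_subst (\<Gamma>(x \<mapsto> A)) \<theta>' \<Longrightarrow> computes S (msubst \<theta>' (inst M [Free x]))"
    and "is_value V" "locally_closed V" "reducible A V"
  shows "computes S (inst (msubst \<theta> M) [V])"
  using assms reducible_subst_locally_closed[OF assms(1)]
  by (simp add: inst_msubst_fresh[of \<theta> V x] fresh_def reducible_subst_upd)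

lemma computes_inst2:
  assumes "reducible_subst \<Gamma> \<theta>" "fresh x \<Gamma> M" "fresh y \<Gamma> M" "x \<noteq> y"
    and "\<And>\<theta>'. reducible_subst (\<Gamma>(x \<mapsto> A, y \<mapsto> B)) \<theta>'
      \<Longrightarrow> computes S (msubst \<theta>' (inst M [Free x, Free y]))"
    and "is_value V" "locally_closed V" "reducible A V"
    and "is_value W" "locally_closed W" "reducible B W"
  shows "computes S (inst (msubst \<theta> M) [V, W])"
  using assms reducible_subst_locally_closed[OF assms(1)]
  by (simp add: inst_msubst_fresh2[of \<theta> V W x _ y] fresh_def reducible_subst_upd)

lemma mtyped_locally_closed_msubst:
  "\<lbrakk>mtyped \<Gamma> M A; reducible_subst \<Gamma>' \<theta>\<rbrakk> \<Longrightarrow> locally_closed (msubst \<theta> M)"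
  by (simp add: closed_below_msubst mtyped_locally_closed reducible_subst_locally_closed)

text \<open>The fundamental lemma of the logical relation. \<theta> is generalised since binders
  extend it. Eliminators evaluate their principal argument by \<open>computes_frame\<close> and then
  treat the resulting value.\<close>

lemma mtyped_computes:
  fixes \<theta> :: "name \<Rightarrow> 'v mterm"
  assumes "mtyped \<Gamma> M A" "reducible_subst \<Gamma> \<theta>"
  shows "computes (reducible A) (msubst \<theta> M)"
  using assms
proof (induction arbitrary: \<theta> rule: mtyped.induct)
  case (mt_star \<Delta>)
  then show ?case by (auto intro: computes_value)
next
  case (mt_var \<Delta> x A)
  then show ?case by (auto simp: reducible_subst_def intro: computes_value)
next
  case (mt_inl \<Gamma> M A B)
  note M = mtyped_locally_closed_msubst[OF mt_inl.hyps mt_inl.prems] mt_inl.IH[OF mt_inl.prems]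
  show ?case unfolding msubst.simps
    by (rule computes_frame[OF frames(1) M(2) M(1)]) (auto intro: computes_value)
next
  case (mt_inr \<Gamma> M B A)
  note M = mtyped_locally_closed_msubst[OF mt_inr.hyps mt_inr.prems] mt_inr.IH[OF mt_inr.prems]
  show ?case unfolding msubst.simps
    by (rule computes_frame[OF frames(2) M(2) M(1)]) (auto intro: computes_value)
next
  case (mt_case \<Gamma> \<Gamma>1 \<Gamma>2 L A B x M C y N)
  note \<theta> = reducible_subst_split[OF mt_case.hyps(1) mt_case.prems]
  show ?case unfolding msubst.simps
    by (rule computes_frame[OF frames(7) mt_case.IH(1)[OF \<theta>(1)]
          mtyped_locally_closed_msubst[OF mt_case.hyps(2) \<theta>(1)]])
      (auto intro: computes_Case computes_inst[OF \<theta>(2)] mt_case.hyps mt_case.IH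
        simp del: reducible.simps)
next
  case (mt_tens \<Gamma> \<Gamma>1 \<Gamma>2 M A N B)
  note \<theta> = reducible_subst_split[OF mt_tens.hyps(1) mt_tens.prems]
  show ?case unfolding msubst.simps
  proof (rule computes_frame[OF frames(8) mt_tens.IH(1)[OF \<theta>(1)]
          mtyped_locally_closed_msubst[OF mt_tens.hyps(2) \<theta>(1)]])
    \<comment> \<open>The left component is now a value; the right one is evaluated with it held
      fixed.\<close>
    fix V :: "'v mterm" assume V: "is_value V" "reducible A V"
    show "computes (reducible (TyTens A B)) (Tens V (msubst \<theta> N))"
      by (rule computes_frame[OF frames(9)[OF V(1)] mt_tens.IH(2)[OF \<theta>(2)]
          mtyped_locally_closed_msubst[OF mt_tens.hyps(3) \<theta>(2)]])
        (use V in \<open>auto intro: computes_value\<close>)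
  qed
next
  case (mt_let_tens \<Gamma> \<Gamma>1 \<Gamma>2 M A B x N y C)
  note \<theta> = reducible_subst_split[OF mt_let_tens.hyps(1) mt_let_tens.prems]
  show ?case unfolding msubst.simps
    by (rule computes_frame[OF frames(10) mt_let_tens.IH(1)[OF \<theta>(1)]
          mtyped_locally_closed_msubst[OF mt_let_tens.hyps(2) \<theta>(1)]])
      (rule computes_LetTens, assumption+,
        rule computes_inst2[OF \<theta>(2) mt_let_tens.hyps(3-5) mt_let_tens.IH(2)], assumption+)
next
  case (mt_lift \<Delta> M A)
  then show ?case by (auto intro: computes_value)
next
  case (mt_force \<Gamma> M A)
  show ?case unfolding msubst.simps
    by (rule computes_frame[OF frames(4) mt_force.IH[OF mt_force.prems]
          mtyped_locally_closed_msubst[OF mt_force.hyps mt_force.prems]])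
      (rule computes_Force)
next
  case (mt_lam x \<Gamma> M A B)
  \<comment> \<open>\<open>Lam\<close> is already a value, so only its clause of
    \<open>reducible\<close> has to be checked.\<close>
  have "computes (reducible B) (inst (msubst \<theta> M) [W])"
    if "is_value W" "locally_closed W" "reducible A W" for W
    by (rule computes_inst[OF mt_lam.prems mt_lam.hyps(1) mt_lam.IH that])
  then show ?case by (intro computes_value) auto
next
  case (mt_app \<Gamma> \<Gamma>1 \<Gamma>2 M A B N)
  note \<theta> = reducible_subst_split[OF mt_app.hyps(1) mt_app.prems]
  show ?case unfolding msubst.simps
  proof (rule computes_frame[OF frames(12) mt_app.IH(1)[OF \<theta>(1)]
          mtyped_locally_closed_msubst[OF mt_app.hyps(2) \<theta>(1)]])
    fix V :: "'v mterm" assume V: "is_value V" "reducible (TyLolli A B) V"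
    show "computes (reducible B) (App V (msubst \<theta> N))"
      by (rule computes_frame[OF frames(13)[OF V(1)] mt_app.IH(2)[OF \<theta>(2)]
          mtyped_locally_closed_msubst[OF mt_app.hyps(3) \<theta>(2)]])
        (rule computes_App[OF V])
  qed
next
  case (mt_zero \<Delta>)
  then show ?case by (auto intro: computes_value)
next
  case (mt_succ \<Gamma> M)
  show ?case unfolding msubst.simps
    by (rule computes_frame[OF frames(3) mt_succ.IH[OF mt_succ.prems]
          mtyped_locally_closed_msubst[OF mt_succ.hyps mt_succ.prems]])
      (auto intro: computes_value)
next
  case (mt_match \<Gamma> \<Gamma>1 \<Gamma>2 L M A x N)
  note \<theta> = reducible_subst_split[OF mt_match.hyps(1) mt_match.prems]
  show ?case unfolding msubst.simps
    by (rule computes_frame[OF frames(11) mt_match.IH(1)[OF \<theta>(1)]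
          mtyped_locally_closed_msubst[OF mt_match.hyps(2) \<theta>(1)]])
      \<comment> \<open>The zero branch binds nothing, so its hypothesis is used with \<theta>
        itself.\<close>
      (auto intro!: computes_MatchNat mt_match.IH(2)[OF \<theta>(2)]
        computes_inst[OF \<theta>(2) mt_match.hyps(4) mt_match.IH(3)])
next
  case (mt_pure \<Delta> t Q)
  then show ?case by (simp only: msubst.simps computes_Pure)
next
  case (mt_meas \<Gamma> M Q)
  show ?case unfolding msubst.simps
    by (rule computes_frame[OF frames(5) mt_meas.IH[OF mt_meas.prems]
          mtyped_locally_closed_msubst[OF mt_meas.hyps mt_meas.prems]])
      (rule computes_Meas)
next
  case (mt_apply u Q1 Q2 \<Gamma> M)
  show ?case unfolding msubst.simps
    by (rule computes_frame[OF frames(6) mt_apply.IH[OF mt_apply.prems]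
          mtyped_locally_closed_msubst[OF mt_apply.hyps(2) mt_apply.prems]])
      (rule computes_ApplyU)
next
  case (mt_gather \<Gamma> \<Gamma>1 \<Gamma>2 M Q1 Q2 z N A)
  note \<theta> = reducible_subst_split[OF mt_gather.hyps(1) mt_gather.prems]
  show ?case unfolding msubst.simps
    by (rule computes_frame[OF frames(14) mt_gather.IH(1)[OF \<theta>(1)]
          mtyped_locally_closed_msubst[OF mt_gather.hyps(2) \<theta>(1)]])
      \<comment> \<open>The variable put into the body is a locally closed value, and
        \<open>reducible\<close> is trivial at \<open>TyB\<close>.\<close>
      (auto intro!: computes_LetGather
        intro: computes_inst[OF \<theta>(2) mt_gather.hyps(3)] mt_gather.IH)
next
  case (mt_divide \<Gamma> \<Gamma>1 \<Gamma>2 M Q1 Q2 x N y A)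
  note \<theta> = reducible_subst_split[OF mt_divide.hyps(1) mt_divide.prems]
  show ?case unfolding msubst.simps
    by (rule computes_frame[OF frames(15) mt_divide.IH(1)[OF \<theta>(1)]
          mtyped_locally_closed_msubst[OF mt_divide.hyps(2) \<theta>(1)]])
      (auto intro!: computes_LetDivide
        intro: computes_inst2[OF \<theta>(2) mt_divide.hyps(3,4,5)] mt_divide.IH)
qed

section \<open>Absence of infinite reductions of configurations\<close>

theorem theorem3p29:
  fixes r :: "basis rel" and C :: config and A :: mty
  assumes "linear_order r"
    and "semi_value_config r C"
    and "wf_config C A"
  shows "\<not> (\<exists>(Cs :: nat \<Rightarrow> config) (p :: nat \<Rightarrow> real).
            Cs 0 = C \<and> (\<forall>n. reduces r (Cs n) (p n) (Cs (Suc n))))"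
proof
  assume "\<exists>(Cs :: nat \<Rightarrow> config) (p :: nat \<Rightarrow> real).
            Cs 0 = C \<and> (\<forall>n. reduces r (Cs n) (p n) (Cs (Suc n)))"
  then obtain Cs and p :: "nat \<Rightarrow> real"
    where Cs: "Cs 0 = C" "\<And>n. reduces r (Cs n) (p n) (Cs (Suc n))"
    by blast
  obtain \<Gamma> where "mtyped \<Gamma> (main_term C) A"
    using assms(3) by (cases C) auto
  \<comment> \<open>Variables are reducible at every type, so sending all names to
    \<open>Free ()\<close> is a reducible substitution for any \<Gamma>; it is the erasure.\<close>
  then have "computes (reducible A) (msubst (\<lambda>_. Free ()) (main_term C))"
    by (rule mtyped_computes) (simp add: reducible_subst_def reducible_Free)
  then have "computes (reducible A) (erase C)"
    by (simp add: msubst_Free)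
  \<comment> \<open>The erased configurations would form an infinite \<open>mstep\<close> sequence
    from \<open>erase C\<close>.\<close>
  from computes_no_infinite_sequence[OF this, of "\<lambda>n. erase (Cs n)"] Cs
  show False
    by (auto dest: reduces_mstep_erase)
qed

end
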